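(* Let $\alpha\in(1/3,1/2]$, let $\mathbf X$ be an $\alpha$-Hölder rough path over $\mathbb R^d$ on $[0,T]$, let $\mathbf Z=(Z,Z')\in\mathcal D^\alpha_{\mathbf X}([0,T];\mathbb R^m)$, let $F_a\in C_b^4(\mathbb R^e;\mathbb R^e)$ for $a\in\{1,\dots,m\}$, and let $(Y,Y')\in\mathcal D^\alpha_{\mathbf X}([0,T];\mathbb R^e)$ be the solution of $dY_t=\sum_aF_a(Y_t)\,d\mathbf Z^a_t$ with initial value $Y_0$. For a partition $\pi_h=\{0=t_0<\cdots<t_N=T\}$ with mesh $h$, let $Y^h$ be the solution of $dY^h_t=\sum_aF_a(Y^h_t)\,dZ^{h,a}_t$, $Y^h_0=Y_0$, with $Z^h$ the piecewise linear interpolation of $Z$ along $\pi_h$. Assume: (1) there exist $C_{\mathrm{WZ}}>0$, $r_0>0$, $h_0>0$ such that $\sup_{0\le t\le T}|Y_t-Y^h_t|\le C_{\mathrm{WZ}}h^{r_0}$ for every partition with mesh $0<h\le h_0$; (2) the simplified controlled Runge-Kutta method with tableau $(A,b)$, $A=(a_{ij})\in\mathbb R^{q\times q}$, $b\in\mathbb R^q$, has solvable stage systems at each step and, with $c_i=\sum_{j=1}^qa_{ij}$, satisfies the third-order conditions $\sum_ib_i=1$, $\sum_ib_ic_i=\frac12$, $\sum_ib_ic_i^2=\frac13$, $\sum_{i,j}b_ia_{ij}c_j=\frac16$; (3) for every $R>0$ there is $L_{R,T}>0$, independent of the partition, such that $|\varphi^h_{s,t}(y)-\varphi^h_{s,t}(\widetilde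 y)|\le L_{R,T}|y-\widetilde y|$ for all $y,\widetilde y\in B_R$, $0\le s\le t\le T$; (4) with $y_0^{\mathrm{SCRK}}:=Y_0$, $y_{n+1}^{\mathrm{SCRK}}:=\Psi^{\mathrm{SCRK}}_{t_n,t_{n+1}}(y_n^{\mathrm{SCRK}})$, the number $R>0$ is such that $y_n^{\mathrm{SCRK}}$, $\varphi^h_{t_n,t_{n+1}}(y_n^{\mathrm{SCRK}})$ and $\Psi^{\mathrm{SCRK}}_{t_n,t_{n+1}}(y_n^{\mathrm{SCRK}})$ all belong to $B_R$ for every $n=0,\dots,N-1$ (for all partitions considered). Then there exists a constant $C_{R,T}>0$, independent of $h$, such that $$\max_{0\le n\le N}|Y_{t_n}-y_n^{\mathrm{SCRK}}|\le C_{R,T}\,h^{\min\{r_0,4\alpha-1\}}.$$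
   Context: $T>0$, $d,m,e,q\in\mathbb N$. $B_R=\{y\in\mathbb R^e:|y|\le R\}$; $h=\max_n|t_{n+1}-t_n|$, $h_n=t_{n+1}-t_n$; $X_{s,t}=X_t-X_s$. $C_b^k$ denotes $k$ times continuously differentiable maps with all derivatives of orders $0,\dots,k$ bounded. Rough and controlled paths. An $\alpha$-Hölder rough path over $\mathbb R^d$ is a pair $\mathbf X=(X,\mathbb X)$ with $X\in C^\alpha([0,T];\mathbb R^d)$ and $\mathbb X:\{0\le s\le t\le T\}\to\mathbb R^{d\times d}$ with $\sup_{s<t}|\mathbb X_{s,t}|/|t-s|^{2\alpha}<\infty$ and $\mathbb X_{s,t}=\mathbb X_{s,u}+\mathbb X_{u,t}+X_{s,u}\otimes X_{u,t}$. $\mathcal D^\alpha_{\mathbf X}([0,T];V)$ is the set of pairs $(Y,Y')$ with $Y\in C^\alpha([0,T];V)$, $Y'\in C^\alpha([0,T];\mathcal L(\mathbb R^d,V))$ and $\sup_{s<t}|Y_{s,t}-Y'_sX_{s,t}|/|t-s|^{2\alpha}<\infty$. The controlled rough integral is $\int_s^tH_r\,d\mathbf Z_r:=\lim_{|P|\to0}\sum_{[u,v]\in P}(H_uZ_{u,v}+(H'_u\diamond Z'_u)\mathbb X_{u,v})$ with $(A\diamond B)(x\otimes\tilde x):=A(x)(B\tilde x)$. With $F(y)e_a=F_a(y)$, a solution is $(Y,Y')\in\mathcal D^\alpha_{\mathbf X}([0,T];\mathbb R^e)$ with $Y_t=Y_0+\int_0^tF(Y_r)\,d\mathbf Z_r$,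 $Y'_t=F(Y_t)Z'_t$, where $F(Y)$ has Gubinelli derivative $DF(Y_t)Y'_t$. Interpolation: $Z^h_t=Z_{t_n}+\frac{t-t_n}{h_n}(Z_{t_{n+1}}-Z_{t_n})$ for $t\in(t_n,t_{n+1}]$, $Z^h_0=Z_0$; the equation driven by $Z^h$ is, on each $(t_n,t_{n+1})$, the ODE $\frac{d}{dt}Y^h_t=\sum_aF_a(Y^h_t)\frac{Z^a_{t_{n+1}}-Z^a_{t_n}}{h_n}$. $\varphi^h_{s,t}(y)$ is the value at time $t$ of the solution of this equation started from $y$ at time $s$. Simplified controlled Runge-Kutta method: with $\Delta Z^a_{u,v}=Z^a_v-Z^a_u$, the stages are $Y_i^{u,v}(y)=y+\sum_{a=1}^m\sum_{j=1}^qa_{ij}\Delta Z^a_{u,v}F_a(Y_j^{u,v}(y))$, $i=1,\dots,q$ (a solution, assumed to exist at each step when $A$ is not strictly lower triangular), and $\Psi^{\mathrm{SCRK}}_{u,v}(y)=y+\sum_{a=1}^m\sum_{i=1}^qb_i\Delta Z^a_{u,v}F_a(Y_i^{u,v}(y))$. *)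

theory Defs
  imports "HOL-Analysis.Analysis"
begin

definition hoelder_on :: "real set \<Rightarrow> real \<Rightarrow> (real \<Rightarrow> 'a::real_normed_vector) \<Rightarrow> bool" where
  "hoelder_on S \<alpha> f \<longleftrightarrow> (\<exists>C. \<forall>s\<in>S. \<forall>t\<in>S. norm (f t - f s) \<le> C * \<bar>t - s\<bar> powr \<alpha>)"

definition tensor :: "real^'d \<Rightarrow> real^'d \<Rightarrow> real^'d^'d" where
  "tensor x y = (\<chi> i j. x $ i * y $ j)"

definition rough_path ::
    "real \<Rightarrow> real \<Rightarrow> (real \<Rightarrow> real^'d) \<Rightarrow> (real \<Rightarrow> real \<Rightarrow> real^'d^'d) \<Rightarrow> bool" where
  "rough_path T \<alpha> X XX \<longleftrightarrow>
     hoelder_on {0..T} \<alpha> X \<and>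
     (\<exists>C. \<forall>s t. 0 \<le> s \<and> s < t \<and> t \<le> T \<longrightarrow> norm (XX s t) \<le> C * (t - s) powr (2 * \<alpha>)) \<and>
     (\<forall>s u t. 0 \<le> s \<and> s \<le> u \<and> u \<le> t \<and> t \<le> T \<longrightarrow>
        XX s t = XX s u + XX u t + tensor (X u - X s) (X t - X u))"

definition controlled_path ::
    "real \<Rightarrow> real \<Rightarrow> (real \<Rightarrow> real^'d) \<Rightarrow> (real \<Rightarrow> 'v::real_normed_vector)
       \<Rightarrow> (real \<Rightarrow> (real^'d) \<Rightarrow>\<^sub>L 'v) \<Rightarrow> bool" where
  "controlled_path T \<alpha> X Y Y' \<longleftrightarrow>
     hoelder_on {0..T} \<alpha> Y \<and> hoelder_on {0..T} \<alpha> Y' \<and>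
     (\<exists>C. \<forall>s t. 0 \<le> s \<and> s < t \<and> t \<le> T \<longrightarrow>
        norm (Y t - Y s - blinfun_apply (Y' s) (X t - X s)) \<le> C * (t - s) powr (2 * \<alpha>))"

text \<open>A partition is the strictly increasing list of its points; it has
  \<open>length ts - 1\<close> subintervals. The inserted 0 only matters for the degenerate
  one-point partition of \<open>{a..a}\<close>.\<close>

definition partition_of :: "real \<Rightarrow> real \<Rightarrow> real list \<Rightarrow> bool" where
  "partition_of a b ts \<longleftrightarrow> ts \<noteq> [] \<and> sorted_wrt (<) ts \<and> hd ts = a \<and> last ts = b"

definition mesh :: "real list \<Rightarrow> real" where
  "mesh ts = Max (insert 0 ((\<lambda>n. ts ! Suc n - ts ! n) ` {..<length ts - 1}))"

text \<open>Linear extension to all matrices of \<open>(A \<diamond> B)(x \<otimes> y) = A(x)(B y)\<close>.\<close>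

definition diamond ::
    "((real^'d) \<Rightarrow>\<^sub>L ((real^'m) \<Rightarrow>\<^sub>L 'v::real_normed_vector)) \<Rightarrow> ((real^'d) \<Rightarrow>\<^sub>L (real^'m))
       \<Rightarrow> real^'d^'d \<Rightarrow> 'v" where
  "diamond A B M =
     (\<Sum>i\<in>UNIV. \<Sum>j\<in>UNIV.
        (M $ i $ j) *\<^sub>R blinfun_apply (blinfun_apply A (axis i 1)) (blinfun_apply B (axis j 1)))"

lemma diamond_tensor:
  "diamond A B (tensor x y) = blinfun_apply (blinfun_apply A x) (blinfun_apply B y)"
proof -
  have basis: "x = (\<Sum>i\<in>UNIV. (x $ i) *\<^sub>R axis i 1)" for x :: "real^'d"
    by (simp add: vec_eq_iff axis_def if_distrib cong: if_cong)
  have "blinfun_apply (blinfun_apply A x) (blinfun_apply B y)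
      = blinfun_apply (blinfun_apply A (\<Sum>i\<in>UNIV. (x $ i) *\<^sub>R axis i 1))
          (blinfun_apply B (\<Sum>j\<in>UNIV. (y $ j) *\<^sub>R axis j 1))"
    using basis[of x] basis[of y] by metis
  also have "\<dots> = diamond A B (tensor x y)"
    by (simp add: diamond_def tensor_def blinfun.sum_right blinfun.sum_left
        blinfun.scaleR_right blinfun.scaleR_left scaleR_sum_right, subst sum.swap)
       (simp add: mult.commute)
  finally show ?thesis by simp
qed

text \<open>\<open>I\<close> is the limit, as the mesh of partitions of \<open>[s,t]\<close> tends to 0, of the compensated
  sums defining the integral of the controlled path \<open>(H, H')\<close> against \<open>(Z, Z')\<close>.\<close>

definition has_rough_integral ::
    "(real \<Rightarrow> real \<Rightarrow> real^'d^'d)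
       \<Rightarrow> (real \<Rightarrow> (real^'m) \<Rightarrow>\<^sub>L 'v::real_normed_vector)
       \<Rightarrow> (real \<Rightarrow> (real^'d) \<Rightarrow>\<^sub>L ((real^'m) \<Rightarrow>\<^sub>L 'v))
       \<Rightarrow> (real \<Rightarrow> real^'m) \<Rightarrow> (real \<Rightarrow> (real^'d) \<Rightarrow>\<^sub>L (real^'m))
       \<Rightarrow> real \<Rightarrow> real \<Rightarrow> 'v \<Rightarrow> bool" where
  "has_rough_integral XX H H' Z Z' s t I \<longleftrightarrow>
     (\<forall>\<epsilon>>0. \<exists>\<delta>>0. \<forall>ts. partition_of s t ts \<and> mesh ts < \<delta> \<longrightarrow>
        norm ((\<Sum>n<length ts - 1.
                 blinfun_apply (H (ts ! n)) (Z (ts ! Suc n) - Z (ts ! n))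
                 + diamond (H' (ts ! n)) (Z' (ts ! n)) (XX (ts ! n) (ts ! Suc n))) - I) < \<epsilon>)"

definition has_C_derivative ::
    "('a::real_normed_vector \<Rightarrow> 'b::real_normed_vector) \<Rightarrow> ('a \<Rightarrow> 'a \<Rightarrow>\<^sub>L 'b) \<Rightarrow> bool" where
  "has_C_derivative f f' \<longleftrightarrow>
     (\<forall>x. (f has_derivative blinfun_apply (f' x)) (at x)) \<and> continuous_on UNIV f'"

text \<open>The class \<open>C\<^sub>b\<^sup>4\<close>: the iterated Frechet derivatives of orders 0 to 4 exist, are
  continuous and are bounded on the whole space.\<close>

definition Cb4 :: "('a::real_normed_vector \<Rightarrow> 'b::real_normed_vector) \<Rightarrow> bool" where
  "Cb4 f \<longleftrightarrow> bounded (range f) \<and>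
     (\<exists>f1 f2 f3 f4.
        has_C_derivative f f1 \<and> bounded (range f1) \<and>
        has_C_derivative f1 f2 \<and> bounded (range f2) \<and>
        has_C_derivative f2 f3 \<and> bounded (range f3) \<and>
        has_C_derivative f3 f4 \<and> bounded (range f4))"

text \<open>The operator \<open>F(y)\<close> with \<open>F(y) e\<^sub>a = F\<^sub>a(y)\<close>.\<close>

definition vf_op ::
    "('m::finite \<Rightarrow> 'v::real_normed_vector \<Rightarrow> 'v) \<Rightarrow> 'v \<Rightarrow> (real^'m) \<Rightarrow>\<^sub>L 'v" where
  "vf_op F y = Blinfun (\<lambda>z. \<Sum>a\<in>UNIV. (z $ a) *\<^sub>R F a y)"

lemma vf_op_apply: "blinfun_apply (vf_op F y) z = (\<Sum>a\<in>UNIV. (z $ a) *\<^sub>R F a y)"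
  unfolding vf_op_def
  by (subst bounded_linear_Blinfun_apply)
     (auto intro!: bounded_linear_sum bounded_linear_scaleR_const bounded_linear_vec_nth)

definition rde_solution ::
    "real \<Rightarrow> real \<Rightarrow> (real \<Rightarrow> real^'d) \<Rightarrow> (real \<Rightarrow> real \<Rightarrow> real^'d^'d)
       \<Rightarrow> (real \<Rightarrow> real^'m) \<Rightarrow> (real \<Rightarrow> (real^'d) \<Rightarrow>\<^sub>L (real^'m))
       \<Rightarrow> ('m \<Rightarrow> real^'e \<Rightarrow> real^'e)
       \<Rightarrow> (real \<Rightarrow> real^'e) \<Rightarrow> (real \<Rightarrow> (real^'d) \<Rightarrow>\<^sub>L (real^'e)) \<Rightarrow> bool" where
  "rde_solution T \<alpha> X XX Z Z' F Y Y' \<longleftrightarrow>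
     controlled_path T \<alpha> X Y Y' \<and>
     (\<forall>t\<in>{0..T}.
        has_rough_integral XX
          (\<lambda>r. vf_op F (Y r))
          (\<lambda>r. Blinfun (frechet_derivative (vf_op F) (at (Y r))) o\<^sub>L Y' r)
          Z Z' 0 t (Y t - Y 0) \<and>
        Y' t = vf_op F (Y t) o\<^sub>L Z' t)"

text \<open>\<open>U\<close> solves, on \<open>[s,t]\<close>, the equation driven by the piecewise linear interpolation of \<open>Z\<close>
  along \<open>ts\<close>; on each open subinterval the interpolation has the constant slope used below.\<close>

definition wz_solution ::
    "('m::finite \<Rightarrow> real^'e \<Rightarrow> real^'e) \<Rightarrow> (real \<Rightarrow> real^'m) \<Rightarrow> real list
       \<Rightarrow> real \<Rightarrow> real \<Rightarrow> (real \<Rightarrow> real^'e) \<Rightarrow> bool" where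
  "wz_solution F Z ts s t U \<longleftrightarrow>
     continuous_on {s..t} U \<and>
     (\<forall>n<length ts - 1. \<forall>r\<in>{ts ! n <..< ts ! Suc n} \<inter> {s<..<t}.
        (U has_vector_derivative
           (\<Sum>a\<in>UNIV. ((Z (ts ! Suc n) $ a - Z (ts ! n) $ a) / (ts ! Suc n - ts ! n)) *\<^sub>R F a (U r)))
        (at r))"

text \<open>The flow \<open>\<phi>\<^sub>s\<^sub>,\<^sub>t(y)\<close> of that equation.\<close>

definition wz_flow ::
    "('m::finite \<Rightarrow> real^'e \<Rightarrow> real^'e) \<Rightarrow> (real \<Rightarrow> real^'m) \<Rightarrow> real list
       \<Rightarrow> real \<Rightarrow> real \<Rightarrow> real^'e \<Rightarrow> real^'e" where
  "wz_flow F Z ts s t y = (THE v. \<exists>U. wz_solution F Z ts s t U \<and> U s = y \<and> U t = v)"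

text \<open>Stage systems of implicit methods may have
  several solutions, so the stages enter as a chosen family \<open>K u v y i\<close>, standing for
  \<open>Y\<^sub>i\<close> on the step from \<open>u\<close> to \<open>v\<close> started at \<open>y\<close>; \<open>scrk_stages\<close> says that a family of vectors
  solves the stage system of this step.\<close>

definition scrk_stages ::
    "('m::finite \<Rightarrow> real^'e \<Rightarrow> real^'e) \<Rightarrow> (real \<Rightarrow> real^'m) \<Rightarrow> real^'q^'q
       \<Rightarrow> real \<Rightarrow> real \<Rightarrow> real^'e \<Rightarrow> ('q::finite \<Rightarrow> real^'e) \<Rightarrow> bool" where
  "scrk_stages F Z A u v y k \<longleftrightarrow>
     (\<forall>i. k i = y + (\<Sum>a\<in>UNIV. \<Sum>j\<in>UNIV. (A $ i $ j * (Z v $ a - Z u $ a)) *\<^sub>R F a (k j)))"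

definition scrk_step ::
    "('m::finite \<Rightarrow> real^'e \<Rightarrow> real^'e) \<Rightarrow> (real \<Rightarrow> real^'m) \<Rightarrow> real^'q
       \<Rightarrow> (real \<Rightarrow> real \<Rightarrow> real^'e \<Rightarrow> 'q::finite \<Rightarrow> real^'e)
       \<Rightarrow> real \<Rightarrow> real \<Rightarrow> real^'e \<Rightarrow> real^'e" where
  "scrk_step F Z b K u v y =
     y + (\<Sum>a\<in>UNIV. \<Sum>i\<in>UNIV. (b $ i * (Z v $ a - Z u $ a)) *\<^sub>R F a (K u v y i))"

primrec scrk_seq ::
    "('m::finite \<Rightarrow> real^'e \<Rightarrow> real^'e) \<Rightarrow> (real \<Rightarrow> real^'m) \<Rightarrow> real^'q
       \<Rightarrow> (real \<Rightarrow> real \<Rightarrow> real^'e \<Rightarrow> 'q::finite \<Rightarrow> real^'e)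
       \<Rightarrow> real list \<Rightarrow> real^'e \<Rightarrow> nat \<Rightarrow> real^'e" where
  "scrk_seq F Z b K ts y0 0 = y0"
| "scrk_seq F Z b K ts y0 (Suc n) =
     scrk_step F Z b K (ts ! n) (ts ! Suc n) (scrk_seq F Z b K ts y0 n)"

definition third_order_conditions :: "real^'q^'q \<Rightarrow> real^'q::finite \<Rightarrow> bool" where
  "third_order_conditions A b \<longleftrightarrow>
     (let c = (\<lambda>i. \<Sum>j\<in>UNIV. A $ i $ j) in
        (\<Sum>i\<in>UNIV. b $ i) = 1 \<and>
        (\<Sum>i\<in>UNIV. b $ i * c i) = 1 / 2 \<and>
        (\<Sum>i\<in>UNIV. b $ i * (c i)\<^sup>2) = 1 / 3 \<and>
        (\<Sum>i\<in>UNIV. \<Sum>j\<in>UNIV. b $ i * A $ i $ j * c j) = 1 / 6)"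

end

theory Submission
  imports Defs
begin

text \<open>
  On one step with increment \<open>x = Z\<^sub>v - Z\<^sub>u\<close>, both the interpolated equation and the Runge--Kutta
  method only see the single autonomous field \<open>G = \<Sum>\<^sub>a x\<^sub>a F\<^sub>a\<close>: after rescaling the step to \<open>[0,1]\<close>
  the flow is the time-one flow of \<open>G\<close>, and the method is the classical Runge--Kutta step of
  size 1 for \<open>G\<close>. The field \<open>G\<close> and its derivatives up to order three are bounded by
  \<open>\<kappa> = B |x|\<close>, so \<open>\<kappa>\<close> plays the role of the step size: the elementary differentials \<open>G\<close>, \<open>G'G\<close>, \<open>G'G'G\<close>, \<open>G''(G,G)\<close> have sizes \<open>\<kappa>\<close>, \<open>\<kappa>\<^sup>2\<close>, \<open>\<kappa>\<^sup>3\<close>,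
  \<open>\<kappa>\<^sup>3\<close>. The third-order conditions say exactly that the two expansions agree up to
  \<open>O(\<kappa>\<^sup>4)\<close> (\<open>exact_flow_expansion\<close>, \<open>runge_kutta_expansion\<close>, combined in \<open>local_error\<close>).

  Since \<open>Z\<close> is \<open>\<alpha>\<close>-Hoelder, the local error on a step of length \<open>\<tau>\<close> is at most a constant times
  \<open>\<tau>\<^bsup>4\<alpha>\<^esup> \<le> h\<^bsup>4\<alpha>-1\<^esup> \<tau>\<close>. Transporting each local error to the final time by the flow costs a
  factor \<open>L\<close>, by the uniform Lipschitz hypothesis, and the lengths \<open>\<tau>\<close> add up to at most \<open>T\<close>
  (\<open>one_step_global_error\<close>). The triangle inequality with the assumed rate
  \<open>r\<^sub>0\<close> for the interpolated equation gives the claim.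

  The flow is given by a description operator, so it says something only once the interpolated
  equation is known to be uniquely solvable. For a small mesh this is a contraction argument:
  then \<open>\<kappa> \<le> 1/2\<close> on every step, so Picard's operator contracts on a whole step
  at once, and step solutions are glued at the grid points. For a mesh bounded away from 0
  the claim holds because both \<open>Y\<close> and the numerical values are bounded.
\<close>

section \<open>Taylor expansion of a vector field with bounded derivatives\<close>

lemma norm_increment_le:
  fixes f :: "real \<Rightarrow> 'a::real_normed_vector"
  assumes "a \<le> b" "continuous_on {a..b} f"
    and "\<And>x. x \<in> {a<..<b} \<Longrightarrow> (f has_vector_derivative f' x) (at x)"
    and "\<And>x. x \<in> {a<..<b} \<Longrightarrow> norm (f' x) \<le> B"
  shows "norm (f b - f a) \<le> B * (b - a)"
proof (cases "a = b")
  case False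
  have "norm (f b - f a) \<le> B * b - B * a"
    using assms False
    by (intro differentiable_bound_general[where f' = f' and \<phi>' = "\<lambda>_. B"])
       (auto intro!: continuous_intros derivative_eq_intros)
  then show ?thesis by (simp add: algebra_simps)
qed simp

text \<open>A field whose derivatives up to order three all satisfy one and the same bound \<open>\<kappa>\<close>. Sharing the
  bound is what makes \<open>\<kappa>\<close> usable as the small parameter: a composition of \<open>n\<close> of these maps is
  of order \<open>\<kappa>\<^sup>n\<close>.\<close>

locale bounded_C3_field =
  fixes G :: "'v::real_normed_vector \<Rightarrow> 'v"
    and G1 :: "'v \<Rightarrow> 'v \<Rightarrow>\<^sub>L 'v" and G2 :: "'v \<Rightarrow> 'v \<Rightarrow>\<^sub>L 'v \<Rightarrow>\<^sub>L 'v"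
    and G3 :: "'v \<Rightarrow> 'v \<Rightarrow>\<^sub>L 'v \<Rightarrow>\<^sub>L 'v \<Rightarrow>\<^sub>L 'v" and \<kappa> :: real
  assumes deriv: "\<And>x. (G has_derivative G1 x) (at x)" "\<And>x. (G1 has_derivative G2 x) (at x)"
      "\<And>x. (G2 has_derivative G3 x) (at x)"
    and bound: "\<And>x. norm (G x) \<le> \<kappa>" "\<And>x. norm (G1 x) \<le> \<kappa>" "\<And>x. norm (G2 x) \<le> \<kappa>"
      "\<And>x. norm (G3 x) \<le> \<kappa>"
begin

lemma kappa_nonneg: "0 \<le> \<kappa>"
  using bound(1) norm_ge_zero order_trans by blast

lemma norm_G1_le: "norm (G1 x v) \<le> \<kappa> * norm v"
  by (meson bound(2) mult_right_mono norm_blinfun norm_ge_zero order_trans)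

lemma norm_G2_le: "norm (G2 x v w) \<le> \<kappa> * norm v * norm w"
proof -
  have "norm (G2 x v) \<le> \<kappa> * norm v"
    by (meson bound(3) mult_right_mono norm_blinfun norm_ge_zero order_trans)
  then show ?thesis
    by (meson mult_right_mono norm_blinfun norm_ge_zero order_trans)
qed

lemma G_lipschitz: "norm (G x - G y) \<le> \<kappa> * norm (x - y)"
  using deriv(1) bound(2) by (intro differentiable_bound[of UNIV G "\<lambda>x. G1 x"])
    (auto simp: norm_blinfun.rep_eq[symmetric])

lemma G2_lipschitz: "norm (G2 x - G2 y) \<le> \<kappa> * norm (x - y)"
  using deriv(3) bound(4) by (intro differentiable_bound[of UNIV G2 "\<lambda>x. G3 x"])
    (auto simp: norm_blinfun.rep_eq[symmetric])

lemma has_vector_derivative_along: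
  assumes "\<And>x. (f has_derivative blinfun_apply (f' x)) (at x)"
  shows "((\<lambda>s. f (y + s *\<^sub>R z)) has_vector_derivative f' (y + s *\<^sub>R z) z) (at s)"
proof -
  have "((\<lambda>s. y + s *\<^sub>R z) has_derivative (\<lambda>h. h *\<^sub>R z)) (at s)"
    by (auto intro!: derivative_eq_intros)
  from has_derivative_compose[OF this assms] show ?thesis
    by (simp add: has_vector_derivative_def blinfun.scaleR_right)
qed

text \<open>The Taylor estimates are obtained along the segment from \<open>y\<close> to \<open>y + z\<close>, where they
  become mean value estimates in one real variable. The mean value inequality is applied to a crude bound over
  the whole segment, which costs the factors \<open>1/2\<close> and \<open>1/6\<close> of the sharp remainders.\<close>

lemma G1_taylor: "norm (G1 (y + z) - G1 y - G2 y z) \<le> \<kappa> * norm z ^ 2"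
proof -
  define f where "f s = G1 (y + s *\<^sub>R z) - s *\<^sub>R G2 y z" for s
  have d: "(f has_vector_derivative (G2 (y + s *\<^sub>R z) z - G2 y z)) (at s)" for s
    unfolding f_def
    by (rule has_vector_derivative_diff has_vector_derivative_along deriv)+
       (auto intro!: derivative_eq_intros simp: has_vector_derivative_def)
  have n: "norm (G2 (y + s *\<^sub>R z) z - G2 y z) \<le> \<kappa> * norm z ^ 2" if "s \<in> {0<..<1}" for s
  proof -
    have "norm ((G2 (y + s *\<^sub>R z) - G2 y) z) \<le> norm (G2 (y + s *\<^sub>R z) - G2 y) * norm z"
      by (rule norm_blinfun)
    also have "\<dots> \<le> (\<kappa> * norm (s *\<^sub>R z)) * norm z"
      using G2_lipschitz[of "y + s *\<^sub>R z" y] by (intro mult_right_mono) auto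
    also have "\<dots> \<le> (\<kappa> * (1 * norm z)) * norm z"
      using that kappa_nonneg
      unfolding norm_scaleR by (intro mult_right_mono mult_left_mono) auto
    finally show ?thesis by (simp add: blinfun.diff_left power2_eq_square mult_ac)
  qed
  have "norm (f 1 - f 0) \<le> \<kappa> * norm z ^ 2 * (1 - 0)"
    using d n by (intro norm_increment_le[of 0 1])
      (auto intro!: continuous_at_imp_continuous_on has_vector_derivative_continuous)
  then show ?thesis by (simp add: f_def algebra_simps)
qed

lemma G_taylor_2: "norm (G (y + z) - G y - G1 y z - (1/2) *\<^sub>R G2 y z z) \<le> \<kappa> * norm z ^ 3"
proof -
  define f where "f s = G (y + s *\<^sub>R z) - s *\<^sub>R G1 y z - (s\<^sup>2 / 2) *\<^sub>R G2 y z z" for s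
  have d: "(f has_vector_derivative (G1 (y + s *\<^sub>R z) z - G1 y z - s *\<^sub>R G2 y z z)) (at s)" for s
    unfolding f_def
    by (rule has_vector_derivative_diff has_vector_derivative_along deriv)+
       (auto intro!: derivative_eq_intros simp: has_vector_derivative_def)
  have n: "norm (G1 (y + s *\<^sub>R z) z - G1 y z - s *\<^sub>R G2 y z z) \<le> \<kappa> * norm z ^ 3"
    if "s \<in> {0<..<1}" for s
  proof -
    have "norm ((G1 (y + s *\<^sub>R z) - G1 y - G2 y (s *\<^sub>R z)) z)
        \<le> norm (G1 (y + s *\<^sub>R z) - G1 y - G2 y (s *\<^sub>R z)) * norm z"
      by (rule norm_blinfun)
    also have "\<dots> \<le> (\<kappa> * norm (s *\<^sub>R z) ^ 2) * norm z"
      by (intro mult_right_mono G1_taylor) auto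
    also have "\<dots> \<le> (\<kappa> * (1 * norm z) ^ 2) * norm z"
      using that kappa_nonneg
      unfolding norm_scaleR by (intro mult_right_mono mult_left_mono power_mono) auto
    finally show ?thesis
      by (simp add: blinfun.diff_left blinfun.scaleR_right blinfun.scaleR_left
          power2_eq_square power3_eq_cube mult_ac)
  qed
  have "norm (f 1 - f 0) \<le> \<kappa> * norm z ^ 3 * (1 - 0)"
    using d n by (intro norm_increment_le[of 0 1])
      (auto intro!: continuous_at_imp_continuous_on has_vector_derivative_continuous)
  then show ?thesis by (simp add: f_def algebra_simps)
qed

lemma G_taylor_1: "norm (G (y + z) - G y - G1 y z) \<le> \<kappa> * norm z ^ 2"
proof -
  define f where "f s = G (y + s *\<^sub>R z) - s *\<^sub>R G1 y z" for s
  have d: "(f has_vector_derivative (G1 (y + s *\<^sub>R z) z - G1 y z)) (at s)" for s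
    unfolding f_def
    by (rule has_vector_derivative_diff has_vector_derivative_along deriv)+
       (auto intro!: derivative_eq_intros simp: has_vector_derivative_def)
  have n: "norm (G1 (y + s *\<^sub>R z) z - G1 y z) \<le> \<kappa> * norm z ^ 2" if "s \<in> {0<..<1}" for s
  proof -
    have "norm (G1 (y + s *\<^sub>R z) - G1 y) \<le> \<kappa> * norm (s *\<^sub>R z)"
      using deriv(2) bound(3) differentiable_bound[of UNIV G1 "\<lambda>x. G2 x" \<kappa> "y + s *\<^sub>R z" y]
      by (auto simp: norm_blinfun.rep_eq[symmetric])
    also have "\<dots> \<le> \<kappa> * (1 * norm z)"
      using that kappa_nonneg
      unfolding norm_scaleR by (intro mult_right_mono mult_left_mono) auto
    finally have "norm (G1 (y + s *\<^sub>R z) - G1 y) * norm z \<le> \<kappa> * norm z * norm z"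
      by (intro mult_right_mono) auto
    moreover have "norm ((G1 (y + s *\<^sub>R z) - G1 y) z) \<le> norm (G1 (y + s *\<^sub>R z) - G1 y) * norm z"
      by (rule norm_blinfun)
    ultimately show ?thesis by (simp add: blinfun.diff_left power2_eq_square mult_ac)
  qed
  have "norm (f 1 - f 0) \<le> \<kappa> * norm z ^ 2 * (1 - 0)"
    using d n by (intro norm_increment_le[of 0 1])
      (auto intro!: continuous_at_imp_continuous_on has_vector_derivative_continuous)
  then show ?thesis by (simp add: f_def algebra_simps)
qed

section \<open>Expansions along perturbed arguments\<close>

text \<open>The displacement of \<open>w\<close> from \<open>y\<close> need only be known up to \<open>O(\<kappa>\<^sup>2)\<close> to get \<open>G w\<close> up to \<open>O(\<kappa>\<^sup>3)\<close>:
  evaluating \<open>G\<close> gains one order, because \<open>G\<close> itself has Lipschitz constant \<open>\<kappa>\<close>. The same estimate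
  is applied below to points \<open>w\<close> of the exact trajectory and to Runge--Kutta stages.\<close>

lemma G_expand_first:
  assumes w: "norm (w - y - a *\<^sub>R G y) \<le> M * \<kappa>^2" and a: "\<bar>a\<bar> \<le> M" and k: "\<kappa> \<le> 1"
  shows "norm (G w - G y - a *\<^sub>R G1 y (G y)) \<le> (4 * M^2 + M) * \<kappa>^3"
proof -
  define z where "z = w - y"
  have M: "0 \<le> M" using a by linarith
  have k2: "\<kappa>^2 \<le> \<kappa>"
    using kappa_nonneg k by (simp add: power2_eq_square mult_left_le_one_le)
  have aG: "norm (a *\<^sub>R G y) \<le> M * \<kappa>"
    using a bound(1)[of y] M by (simp add: mult_mono)
  have z: "norm z \<le> 2 * M * \<kappa>"
    using norm_triangle_ineq[of "w - y - a *\<^sub>R G y" "a *\<^sub>R G y"] w aG mult_left_mono[OF k2 M]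
    by (simp add: z_def)
  have "G w - G y - a *\<^sub>R G1 y (G y) = (G (y + z) - G y - G1 y z) + G1 y (w - y - a *\<^sub>R G y)"
    by (simp add: z_def blinfun.diff_right blinfun.scaleR_right)
  then have "norm (G w - G y - a *\<^sub>R G1 y (G y))
      \<le> norm (G (y + z) - G y - G1 y z) + norm (G1 y (w - y - a *\<^sub>R G y))"
    using norm_triangle_ineq by metis
  also have "\<dots> \<le> \<kappa> * norm z ^ 2 + \<kappa> * norm (w - y - a *\<^sub>R G y)"
    by (intro add_mono G_taylor_1 norm_G1_le)
  also have "\<dots> \<le> \<kappa> * (2 * M * \<kappa>)^2 + \<kappa> * (M * \<kappa>^2)"
    using z w kappa_nonneg by (intro add_mono mult_left_mono power_mono) auto
  finally show ?thesis by (simp add: algebra_simps power2_eq_square power3_eq_cube)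
qed

text \<open>One order further. The second-order Taylor term sees only the leading part \<open>a G y\<close> of the
  displacement, whence the coefficient \<open>a\<^sup>2 / 2\<close>; the correction \<open>b G'G\<close> enters through the
  first-order term alone.\<close>

lemma G_expand_second:
  assumes w: "norm (w - y - a *\<^sub>R G y - b *\<^sub>R G1 y (G y)) \<le> M * \<kappa>^3"
    and a: "\<bar>a\<bar> \<le> M" and b: "\<bar>b\<bar> \<le> M" and k: "\<kappa> \<le> 1"
  shows "norm (G w - (G y + a *\<^sub>R G1 y (G y) + b *\<^sub>R G1 y (G1 y (G y))
      + (a^2 / 2) *\<^sub>R G2 y (G y) (G y))) \<le> (27 * M^3 + 4 * M^2 + M) * \<kappa>^4"
proof -
  define z where "z = w - y"
  define r where "r = z - a *\<^sub>R G y"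
  define q where "q = r - b *\<^sub>R G1 y (G y)"
  have M: "0 \<le> M" using a by linarith
  have q: "norm q \<le> M * \<kappa>^3" using w by (simp add: q_def r_def z_def)
  have k2: "\<kappa>^2 \<le> \<kappa>" and k3: "\<kappa>^3 \<le> \<kappa>^2"
    using kappa_nonneg k
    by (auto simp: power2_eq_square power3_eq_cube mult_left_le_one_le mult_left_le)
  have aG: "norm (a *\<^sub>R G y) \<le> M * \<kappa>"
    using a bound(1)[of y] M by (simp add: mult_mono)
  have "norm (G1 y (G y)) \<le> \<kappa> * \<kappa>"
    using norm_G1_le[of y "G y"] mult_left_mono[OF bound(1)[of y] kappa_nonneg] by linarith
  then have bG: "norm (b *\<^sub>R G1 y (G y)) \<le> M * \<kappa>^2"
    using b M by (simp add: mult_mono power2_eq_square)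
  have r: "norm r \<le> 2 * M * \<kappa>^2"
    using norm_triangle_ineq[of q "b *\<^sub>R G1 y (G y)"] q bG mult_left_mono[OF k3 M]
    by (simp add: q_def)
  have z: "norm z \<le> 3 * M * \<kappa>"
    using norm_triangle_ineq[of r "a *\<^sub>R G y"] r aG mult_left_mono[OF k2 M]
    by (simp add: r_def)
  have "w = y + z" by (simp add: z_def)
  have split: "G w - (G y + a *\<^sub>R G1 y (G y) + b *\<^sub>R G1 y (G1 y (G y)) + (a^2 / 2) *\<^sub>R G2 y (G y) (G y))
      = (G (y + z) - G y - G1 y z - (1/2) *\<^sub>R G2 y z z) + G1 y q
        + (1/2) *\<^sub>R (G2 y r z + G2 y (a *\<^sub>R G y) r)"
    unfolding \<open>w = y + z\<close>
    by (simp add: q_def r_def blinfun.add_right blinfun.diff_right blinfun.scaleR_right blinfun.diff_left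
        blinfun.scaleR_left algebra_simps power2_eq_square)
  have A: "norm (G (y + z) - G y - G1 y z - (1/2) *\<^sub>R G2 y z z) \<le> \<kappa> * (3 * M * \<kappa>) ^ 3"
    using G_taylor_2[of y z] z kappa_nonneg by (meson mult_left_mono power_mono norm_ge_zero order_trans)
  have B: "norm (G1 y q) \<le> \<kappa> * (M * \<kappa>^3)"
    using norm_G1_le[of y q] q kappa_nonneg by (meson mult_left_mono order_trans)
  have C: "norm (G2 y r z) \<le> \<kappa> * (2 * M * \<kappa>^2) * (3 * M * \<kappa>)"
    using norm_G2_le[of y r z] r z kappa_nonneg M
    by (elim order_trans) (intro mult_mono, auto)
  have D: "norm (G2 y (a *\<^sub>R G y) r) \<le> \<kappa> * (M * \<kappa>) * (2 * M * \<kappa>^2)"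
    using norm_G2_le[of y "a *\<^sub>R G y" r] r aG kappa_nonneg M
    by (elim order_trans) (intro mult_mono, auto)
  have E: "norm ((1/2) *\<^sub>R (G2 y r z + G2 y (a *\<^sub>R G y) r))
      \<le> (1/2) * (\<kappa> * (2 * M * \<kappa>^2) * (3 * M * \<kappa>) + \<kappa> * (M * \<kappa>) * (2 * M * \<kappa>^2))"
    unfolding norm_scaleR
    by (intro mult_mono order_trans[OF norm_triangle_ineq] add_mono C D) simp_all
  have "norm (G w - (G y + a *\<^sub>R G1 y (G y) + b *\<^sub>R G1 y (G1 y (G y)) + (a^2 / 2) *\<^sub>R G2 y (G y) (G y)))
      \<le> \<kappa> * (3 * M * \<kappa>) ^ 3 + \<kappa> * (M * \<kappa>^3)
        + (1/2) * (\<kappa> * (2 * M * \<kappa>^2) * (3 * M * \<kappa>) + \<kappa> * (M * \<kappa>) * (2 * M * \<kappa>^2))"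
    unfolding split by (intro order_trans[OF norm_triangle_ineq] add_mono A B E)
  also have "\<dots> = (27 * M^3 + 4 * M^2 + M) * \<kappa>^4"
    by (simp add: algebra_simps power2_eq_square power3_eq_cube power4_eq_xxxx)
  finally show ?thesis .
qed

section \<open>The exact flow and the Runge--Kutta step\<close>

abbreviation third_order_step :: "'v \<Rightarrow> 'v" where
  "third_order_step y \<equiv> y + G y + (1/2) *\<^sub>R G1 y (G y) + (1/6) *\<^sub>R G1 y (G1 y (G y))
     + (1/6) *\<^sub>R G2 y (G y) (G y)"

text \<open>Picard iteration on expansions: an expansion of \<open>u t\<close> up to \<open>O(\<kappa>\<^sup>n)\<close> yields one of \<open>G (u t)\<close> up to
  \<open>O(\<kappa>\<^bsup>n+1\<^esup>)\<close>, and integrating it yields one of \<open>u t\<close> of that order. The constant is the value of the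
  bound of \<open>G_expand_second\<close> at \<open>M = 5\<close>.\<close>

lemma exact_flow_expansion:
  assumes cont: "continuous_on {0..1} u" and u0: "u 0 = y"
    and ode: "\<And>s. s \<in> {0<..<1} \<Longrightarrow> (u has_vector_derivative G (u s)) (at s)"
    and k: "\<kappa> \<le> 1"
  shows "norm (u 1 - third_order_step y) \<le> 3480 * \<kappa>^4"
proof -
  \<comment> \<open>If \<open>p'\<close> approximates \<open>G (u s)\<close> up to \<open>B\<close>, then \<open>y + p\<close> approximates \<open>u\<close> up to \<open>B\<close>.\<close>
  have compare: "norm (u t - y - p t) \<le> B"
    if t: "t \<in> {0..1}" and p0: "p 0 = 0"
      and p: "\<And>s. (p has_vector_derivative p' s) (at s)"
      and B: "\<And>s. s \<in> {0<..<1} \<Longrightarrow> norm (G (u s) - p' s) \<le> B" for t p p' B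
  proof -
    have pc: "continuous_on {0..t} p"
      using p by (auto intro!: continuous_at_imp_continuous_on has_vector_derivative_continuous)
    have uc: "continuous_on {0..t} u" using cont t by (auto intro: continuous_on_subset)
    have "norm ((u t - p t) - (u 0 - p 0)) \<le> B * (t - 0)"
      using t p ode B
      by (intro norm_increment_le[where f' = "\<lambda>s. G (u s) - p' s"])
         (auto intro!: continuous_intros uc pc has_vector_derivative_diff)
    moreover have "0 \<le> B" using B[of "1/2"] norm_ge_zero[of "G (u (1/2)) - p' (1/2)"]
      by (auto simp del: norm_ge_zero intro: order_trans)
    ultimately show ?thesis
      using t u0 p0 mult_left_mono[of t 1 B] by (simp add: algebra_simps)
  qed
  have o0: "norm (u t - y) \<le> \<kappa>" if "t \<in> {0..1}" for t
    using compare[OF that, of "\<lambda>_. 0" "\<lambda>_. 0" \<kappa>] bound(1) by auto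
  have o1: "norm (u t - y - t *\<^sub>R G y) \<le> 1 * \<kappa>^2" if "t \<in> {0..1}" for t
  proof (rule compare[OF that, where p' = "\<lambda>_. G y"])
    fix s :: real assume s: "s \<in> {0<..<1}"
    have "norm (G (u s) - G y) \<le> \<kappa> * norm (u s - y)" by (rule G_lipschitz)
    also have "\<dots> \<le> \<kappa> * \<kappa>" using o0[of s] s kappa_nonneg by (intro mult_left_mono) auto
    finally show "norm (G (u s) - G y) \<le> 1 * \<kappa>^2" by (simp add: power2_eq_square)
  qed (auto intro!: derivative_eq_intros simp: has_vector_derivative_def fun_eq_iff
      algebra_simps power2_eq_square)
  have o2: "norm (u t - y - (t *\<^sub>R G y + (t^2/2) *\<^sub>R G1 y (G y))) \<le> 5 * \<kappa>^3" if "t \<in> {0..1}" for t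
  proof (rule compare[OF that, where p' = "\<lambda>s. G y + s *\<^sub>R G1 y (G y)"])
    fix s :: real assume s: "s \<in> {0<..<1}"
    show "norm (G (u s) - (G y + s *\<^sub>R G1 y (G y))) \<le> 5 * \<kappa>^3"
      using G_expand_first[OF o1[of s] _ k] s by (simp add: algebra_simps)
  qed (auto intro!: derivative_eq_intros simp: has_vector_derivative_def fun_eq_iff
      algebra_simps power2_eq_square)
  have "norm (u 1 - y - (1 *\<^sub>R G y + (1^2/2) *\<^sub>R G1 y (G y) + (1^3/6) *\<^sub>R G1 y (G1 y (G y))
      + (1^3/6) *\<^sub>R G2 y (G y) (G y))) \<le> 3480 * \<kappa>^4"
  proof (rule compare[where p' = "\<lambda>s. G y + s *\<^sub>R G1 y (G y) + (s^2/2) *\<^sub>R G1 y (G1 y (G y))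
      + (s^2/2) *\<^sub>R G2 y (G y) (G y)"])
    fix s :: real assume s: "s \<in> {0<..<1}"
    have "norm (u s - y - s *\<^sub>R G y - (s^2/2) *\<^sub>R G1 y (G y)) \<le> 5 * \<kappa>^3"
      using o2[of s] s by (simp add: algebra_simps)
    moreover have "\<bar>s\<bar> \<le> 5" "\<bar>s^2/2\<bar> \<le> 5"
      using s power_le_one[of s 2] by auto
    ultimately show "norm (G (u s) - (G y + s *\<^sub>R G1 y (G y) + (s^2/2) *\<^sub>R G1 y (G1 y (G y))
      + (s^2/2) *\<^sub>R G2 y (G y) (G y))) \<le> 3480 * \<kappa>^4"
      using G_expand_second[of "u s" y s "s^2/2" 5] k by simp
  qed (auto intro!: derivative_eq_intros simp: has_vector_derivative_def fun_eq_iff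
      algebra_simps power2_eq_square)
  then show ?thesis by (simp add: algebra_simps)
qed

end

lemma norm_weighted_sum_le:
  fixes v :: "'i \<Rightarrow> 'v::real_normed_vector"
  assumes "\<And>i. i \<in> I \<Longrightarrow> norm (v i) \<le> B" "(\<Sum>i\<in>I. \<bar>w i\<bar>) \<le> M" "0 \<le> B"
  shows "norm (\<Sum>i\<in>I. w i *\<^sub>R v i) \<le> M * B"
proof -
  have "norm (\<Sum>i\<in>I. w i *\<^sub>R v i) \<le> (\<Sum>i\<in>I. \<bar>w i\<bar> * B)"
    using assms by (intro sum_norm_le) (auto intro: mult_left_mono)
  also have "\<dots> \<le> M * B"
    using assms by (simp add: sum_distrib_right[symmetric] mult_right_mono)
  finally show ?thesis .
qed

context bounded_C3_field
begin

text \<open>The discrete counterpart: the stage system takes the place of integration, with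
  \<open>c\<^sub>i\<close> and \<open>\<Sum>\<^sub>j a\<^sub>i\<^sub>j c\<^sub>j\<close> replacing \<open>t\<close> and \<open>t\<^sup>2/2\<close>. Any solution of
  the stage system will do, as the bound \<open>\<kappa>\<close> on \<open>G\<close> confines all stages to a neighbourhood of \<open>y\<close>.\<close>

lemma runge_kutta_expansion:
  fixes A :: "real^'q^'q" and b :: "real^'q"
  assumes order: "third_order_conditions A b"
    and k: "\<And>i. k i = y + (\<Sum>j\<in>UNIV. A $ i $ j *\<^sub>R G (k j))"
    and A: "\<And>i. (\<Sum>j\<in>UNIV. \<bar>A $ i $ j\<bar>) \<le> M" and b: "(\<Sum>i\<in>UNIV. \<bar>b $ i\<bar>) \<le> M"
    and M: "1 \<le> M" and N: "N = M * (4 * M^4 + M^2)" and kappa: "\<kappa> \<le> 1"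
  shows "norm (y + (\<Sum>i\<in>UNIV. b $ i *\<^sub>R G (k i)) - third_order_step y)
    \<le> M * ((27 * N^3 + 4 * N^2 + N) * \<kappa>^4)"
proof -
  define c where "c i = (\<Sum>j\<in>UNIV. A $ i $ j)" for i
  define d where "d i = (\<Sum>j\<in>UNIV. A $ i $ j * c j)" for i
  have cM: "\<bar>c i\<bar> \<le> M" for i
    unfolding c_def using sum_abs A order_trans by blast
  have dM: "\<bar>d i\<bar> \<le> M * M" for i
    using norm_weighted_sum_le[of UNIV c M "\<lambda>j. A $ i $ j" M] cM A M by (simp add: d_def)
  have MM: "M \<le> M^2" "M^2 \<le> N" "0 \<le> N"
  proof -
    show "M \<le> M^2" using M by (simp add: power2_eq_square)
    have "1 * M^2 \<le> M * (4 * M^4 + M^2)" using M by (intro mult_mono) auto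
    then show "M^2 \<le> N" by (simp add: N)
    then show "0 \<le> N" using order_trans zero_le_power2 by blast
  qed
  \<comment> \<open>Used with \<open>v = G y\<close> and \<open>w = 0\<close> or \<open>w = G1 y (G y)\<close>: subtracting the expansion of a stage
     amounts to subtracting the lower expansion of the field at every stage.\<close>
  have stage: "k i - y - (c i *\<^sub>R v + d i *\<^sub>R w) = (\<Sum>j\<in>UNIV. A $ i $ j *\<^sub>R (G (k j) - v - c j *\<^sub>R w))"
    for i v w
    by (subst k) (simp add: c_def[of i] d_def algebra_simps sum.distrib sum_subtractf scaleR_sum_left)
  have s0: "norm (k i - y) \<le> M * \<kappa>" for i
    using norm_weighted_sum_le[where v = "\<lambda>j. G (k j)", OF bound(1) A kappa_nonneg]
    by (subst k) simp
  have s1: "norm (k i - y - c i *\<^sub>R G y) \<le> M^2 * \<kappa>^2" for i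
  proof -
    have "norm (G (k j) - G y) \<le> \<kappa> * (M * \<kappa>)" for j
      using G_lipschitz[of "k j" y] mult_left_mono[OF s0[of j] kappa_nonneg] by linarith
    then have "norm (k i - y - (c i *\<^sub>R G y + d i *\<^sub>R 0)) \<le> M * (\<kappa> * (M * \<kappa>))"
      unfolding stage using kappa_nonneg M by (intro norm_weighted_sum_le A) auto
    then show ?thesis by (simp add: power2_eq_square mult_ac)
  qed
  have s2: "norm (k i - y - c i *\<^sub>R G y - d i *\<^sub>R G1 y (G y)) \<le> N * \<kappa>^3" for i
  proof -
    have "norm (G (k j) - G y - c j *\<^sub>R G1 y (G y)) \<le> (4 * (M^2)^2 + M^2) * \<kappa>^3" for j
      using cM[of j] MM s1 kappa by (intro G_expand_first) auto
    then have "norm (k i - y - (c i *\<^sub>R G y + d i *\<^sub>R G1 y (G y))) \<le> M * ((4 * (M^2)^2 + M^2) * \<kappa>^3)"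
      unfolding stage using kappa_nonneg M by (intro norm_weighted_sum_le A) auto
    then show ?thesis by (simp add: N diff_diff_eq mult.assoc add.assoc)
  qed
  define E where "E i = G y + c i *\<^sub>R G1 y (G y) + d i *\<^sub>R G1 y (G1 y (G y))
    + ((c i)^2 / 2) *\<^sub>R G2 y (G y) (G y)" for i
  have "norm (G (k i) - E i) \<le> (27 * N^3 + 4 * N^2 + N) * \<kappa>^4" for i
    unfolding E_def using cM[of i] dM[of i] MM s2 kappa
    by (intro G_expand_second) (auto simp: power2_eq_square)
  then have "norm (\<Sum>i\<in>UNIV. b $ i *\<^sub>R (G (k i) - E i)) \<le> M * ((27 * N^3 + 4 * N^2 + N) * \<kappa>^4)"
    using MM by (intro norm_weighted_sum_le b) auto
  moreover have "(\<Sum>i\<in>UNIV. b $ i *\<^sub>R E i) = third_order_step y - y"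
  proof -
    have sums: "(\<Sum>i\<in>UNIV. b $ i) = 1" "(\<Sum>i\<in>UNIV. b $ i * c i) = 1/2"
        "(\<Sum>i\<in>UNIV. b $ i * (c i)^2) = 1/3" "(\<Sum>i\<in>UNIV. b $ i * d i) = 1/6"
      using order unfolding third_order_conditions_def Let_def c_def d_def
      by (simp_all add: sum_distrib_left mult.assoc)
    have "(\<Sum>i\<in>UNIV. b $ i *\<^sub>R E i) = (\<Sum>i\<in>UNIV. b $ i) *\<^sub>R G y
      + (\<Sum>i\<in>UNIV. b $ i * c i) *\<^sub>R G1 y (G y)
      + (\<Sum>i\<in>UNIV. b $ i * d i) *\<^sub>R G1 y (G1 y (G y))
      + ((\<Sum>i\<in>UNIV. b $ i * (c i)^2) / 2) *\<^sub>R G2 y (G y) (G y)"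
      by (simp add: E_def scaleR_add_right sum.distrib scaleR_sum_left sum_divide_distrib)
    then show ?thesis unfolding sums by simp
  qed
  ultimately show ?thesis
    by (simp add: scaleR_diff_right sum_subtractf algebra_simps)
qed

end

section \<open>Linear combinations of the driving vector fields\<close>

lemma has_derivative_combination:
  assumes "\<And>a. (f a has_derivative blinfun_apply (f' a)) (at u)"
  shows "((\<lambda>u. \<Sum>a\<in>I. w a *\<^sub>R f a u) has_derivative blinfun_apply (\<Sum>a\<in>I. w a *\<^sub>R f' a)) (at u)"
proof -
  have "((\<lambda>u. \<Sum>a\<in>I. w a *\<^sub>R f a u) has_derivative (\<lambda>h. \<Sum>a\<in>I. w a *\<^sub>R f' a h)) (at u)"
    by (intro has_derivative_sum has_derivative_scaleR_right assms)
  moreover have "blinfun_apply (\<Sum>a\<in>I. w a *\<^sub>R f' a) = (\<lambda>h. \<Sum>a\<in>I. w a *\<^sub>R f' a h)"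
    by (simp add: fun_eq_iff blinfun.sum_left blinfun.scaleR_left)
  ultimately show ?thesis by simp
qed

lemma Cb4_bounds:
  fixes f :: "'a::real_normed_vector \<Rightarrow> 'b::real_normed_vector"
  assumes "Cb4 f"
  shows "\<exists>f1 f2 f3 B. (\<forall>x. (f has_derivative blinfun_apply (f1 x)) (at x)) \<and>
    (\<forall>x. (f1 has_derivative blinfun_apply (f2 x)) (at x)) \<and>
    (\<forall>x. (f2 has_derivative blinfun_apply (f3 x)) (at x)) \<and>
    (\<forall>x. norm (f x) \<le> B \<and> norm (f1 x) \<le> B \<and> norm (f2 x) \<le> B \<and> norm (f3 x) \<le> B)"
proof -
  obtain f1 f2 f3 f4 where d: "has_C_derivative f f1" "has_C_derivative f1 f2"
      "has_C_derivative f2 f3" "has_C_derivative f3 f4"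
    and b: "bounded (range f)" "bounded (range f1)" "bounded (range f2)" "bounded (range f3)"
    using assms unfolding Cb4_def by blast
  obtain B0 B1 B2 B3 where B: "\<And>x. norm (f x) \<le> B0" "\<And>x. norm (f1 x) \<le> B1"
      "\<And>x. norm (f2 x) \<le> B2" "\<And>x. norm (f3 x) \<le> B3"
    using b unfolding bounded_iff by blast
  have "\<forall>x. norm (f x) \<le> max (max B0 B1) (max B2 B3) \<and> norm (f1 x) \<le> max (max B0 B1) (max B2 B3)
      \<and> norm (f2 x) \<le> max (max B0 B1) (max B2 B3) \<and> norm (f3 x) \<le> max (max B0 B1) (max B2 B3)"
    using B by (meson max.coboundedI1 max.coboundedI2)
  then show ?thesis using d unfolding has_C_derivative_def by blast
qed

abbreviation increment_field ::
    "('m::finite \<Rightarrow> 'v::real_normed_vector \<Rightarrow> 'v) \<Rightarrow> real^'m \<Rightarrow> 'v \<Rightarrow> 'v" where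
  "increment_field F x u \<equiv> (\<Sum>a\<in>UNIV. (x $ a) *\<^sub>R F a u)"

text \<open>The bound of the combined field is linear in the increment; this turns powers of \<open>\<kappa>\<close> into powers
  of \<open>|x|\<close> in the local error.\<close>

lemma increment_field_bounded_C3:
  fixes F :: "'m::finite \<Rightarrow> 'v::real_normed_vector \<Rightarrow> 'v"
  assumes "\<And>a. Cb4 (F a)"
  shows "\<exists>B>0. \<forall>x::real^'m. \<exists>G1 G2 G3.
    bounded_C3_field (increment_field F x) G1 G2 G3 (B * norm x)"
proof -
  have "\<forall>a. \<exists>f1 f2 f3 B. (\<forall>x. (F a has_derivative blinfun_apply (f1 x)) (at x)) \<and>
    (\<forall>x. (f1 has_derivative blinfun_apply (f2 x)) (at x)) \<and>
    (\<forall>x. (f2 has_derivative blinfun_apply (f3 x)) (at x)) \<and>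
    (\<forall>x. norm (F a x) \<le> B \<and> norm (f1 x) \<le> B \<and> norm (f2 x) \<le> B \<and> norm (f3 x) \<le> B)"
    using Cb4_bounds[OF assms] by blast
  then obtain f1 f2 f3 B where
      d: "\<And>a x. (F a has_derivative blinfun_apply (f1 a x)) (at x)"
        "\<And>a x. (f1 a has_derivative blinfun_apply (f2 a x)) (at x)"
        "\<And>a x. (f2 a has_derivative blinfun_apply (f3 a x)) (at x)"
      and n: "\<And>a x. norm (F a x) \<le> B a" "\<And>a x. norm (f1 a x) \<le> B a"
        "\<And>a x. norm (f2 a x) \<le> B a" "\<And>a x. norm (f3 a x) \<le> B a"
    by metis
  have B0: "0 \<le> B a" for a using n(1) norm_ge_zero order_trans by blast
  define S where "S = (\<Sum>a\<in>UNIV. B a) + 1"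
  have S: "norm (\<Sum>a\<in>UNIV. (x $ a) *\<^sub>R g a) \<le> S * norm x"
    if "\<And>a. norm (g a) \<le> B a" for x :: "real^'m" and g :: "'m \<Rightarrow> 'w::real_normed_vector"
  proof -
    have "norm (\<Sum>a\<in>UNIV. (x $ a) *\<^sub>R g a) \<le> (\<Sum>a\<in>UNIV. norm x * B a)"
      using that by (intro sum_norm_le) (auto intro!: mult_mono component_le_norm_cart)
    also have "\<dots> = norm x * (\<Sum>a\<in>UNIV. B a)" by (simp add: sum_distrib_left)
    also have "\<dots> \<le> S * norm x" by (simp add: S_def algebra_simps)
    finally show ?thesis .
  qed
  show ?thesis
  proof (intro exI[of _ S] conjI allI)
    show "S > 0" using B0 by (simp add: S_def sum_nonneg add_nonneg_pos)
    fix x :: "real^'m"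
    have "bounded_C3_field (increment_field F x) (\<lambda>u. \<Sum>a\<in>UNIV. (x $ a) *\<^sub>R f1 a u)
      (\<lambda>u. \<Sum>a\<in>UNIV. (x $ a) *\<^sub>R f2 a u) (\<lambda>u. \<Sum>a\<in>UNIV. (x $ a) *\<^sub>R f3 a u) (S * norm x)"
      by unfold_locales (intro has_derivative_combination d S n)+
    then show "\<exists>G1 G2 G3. bounded_C3_field (increment_field F x) G1 G2 G3 (S * norm x)"
      by blast
  qed
qed

section \<open>Existence and uniqueness on short intervals\<close>

text \<open>Picard's operator \<open>J\<close> is considered on bounded continuous functions of the whole line, which form
  a complete space, by freezing its values outside \<open>[p,q]\<close> with the clamping map \<open>c\<close>.
  Since \<open>L (q - p) < 1\<close>, it is a contraction there.\<close>

lemma lipschitz_ode_exists: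
  fixes g :: "'v::banach \<Rightarrow> 'v"
  assumes pq: "p \<le> q" and lip: "\<And>x y. norm (g x - g y) \<le> L * norm (x - y)"
    and L: "0 \<le> L" "L * (q - p) < 1"
  shows "\<exists>U. continuous_on {p..q} U \<and> U p = y \<and>
    (\<forall>r\<in>{p<..<q}. (U has_vector_derivative g (U r)) (at r))"
proof -
  have gc: "continuous_on UNIV g"
    using L lip by (intro lipschitz_on_continuous_on[of L] lipschitz_onI) (auto simp: dist_norm)
  define J where "J \<phi> t = y + integral {p..t} (\<lambda>s. g (apply_bcontfun \<phi> s))" for \<phi> :: "real \<Rightarrow>\<^sub>C 'v" and t
  define c where "c t = max p (min q t)" for t
  have cpq: "c t \<in> {p..q}" for t using pq by (auto simp: c_def)
  have integrand: "continuous_on S (\<lambda>s. g (apply_bcontfun \<phi> s))" for S and \<phi> :: "real \<Rightarrow>\<^sub>C 'v"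
    using continuous_on_compose2[OF gc, of S "apply_bcontfun \<phi>"] by auto
  have Jd: "(J \<phi> has_vector_derivative g (apply_bcontfun \<phi> t)) (at t within {p..q})"
    if "t \<in> {p..q}" for \<phi> t
    unfolding J_def using integral_has_vector_derivative[OF integrand that, of \<phi>]
    by (auto intro!: derivative_eq_intros)
  then have Jc: "continuous_on {p..q} (J \<phi>)" for \<phi>
    by (meson continuous_on_eq_continuous_within has_vector_derivative_continuous)
  have Jb: "(\<lambda>t. J \<phi> (c t)) \<in> bcontfun" for \<phi>
  proof -
    have "continuous_on UNIV (\<lambda>t. J \<phi> (c t))"
      using cpq by (intro continuous_on_compose2[OF Jc]) (auto simp: c_def intro!: continuous_intros)
    moreover have "bounded (range (\<lambda>t. J \<phi> (c t)))"
      by (rule bounded_subset[OF compact_imp_bounded[OF compact_continuous_image[OF Jc[of \<phi>]]]])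
         (use cpq in auto)
    ultimately show ?thesis by (simp add: bcontfun_def)
  qed
  define \<Phi> where "\<Phi> \<phi> = Bcontfun (\<lambda>t. J \<phi> (c t))" for \<phi>
  have \<Phi>: "apply_bcontfun (\<Phi> \<phi>) t = J \<phi> (c t)" for \<phi> t
    unfolding \<Phi>_def using Bcontfun_inverse[OF Jb] by metis
  have "\<forall>\<phi> \<psi>. dist (\<Phi> \<phi>) (\<Phi> \<psi>) \<le> (L * (q - p)) * dist \<phi> \<psi>"
  proof (intro allI dist_bound)
    fix \<phi> \<psi> t
    have "J \<phi> (c t) - J \<psi> (c t) = integral {p..c t} (\<lambda>s. g (apply_bcontfun \<phi> s) - g (apply_bcontfun \<psi> s))"
      by (simp add: J_def integral_diff integrable_continuous_real integrand)
    moreover have "norm (integral {p..c t} (\<lambda>s. g (apply_bcontfun \<phi> s) - g (apply_bcontfun \<psi> s)))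
        \<le> (L * dist \<phi> \<psi>) * (c t - p)"
    proof (rule integral_bound)
      show "p \<le> c t" using cpq[of t] by auto
      show "continuous_on {p..c t} (\<lambda>s. g (apply_bcontfun \<phi> s) - g (apply_bcontfun \<psi> s))"
        by (intro continuous_on_diff integrand)
      show "norm (g (apply_bcontfun \<phi> s) - g (apply_bcontfun \<psi> s)) \<le> L * dist \<phi> \<psi>" for s
        using lip[of "apply_bcontfun \<phi> s" "apply_bcontfun \<psi> s"]
          mult_left_mono[OF dist_bounded[of \<phi> s \<psi>] L(1)] by (simp add: dist_norm)
    qed
    moreover have "(L * dist \<phi> \<psi>) * (c t - p) \<le> (L * dist \<phi> \<psi>) * (q - p)"
      using cpq[of t] L by (intro mult_left_mono) auto
    ultimately show "dist (apply_bcontfun (\<Phi> \<phi>) t) (apply_bcontfun (\<Phi> \<psi>) t) \<le> (L * (q - p)) * dist \<phi> \<psi>"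
      by (simp add: \<Phi> dist_norm mult_ac)
  qed
  then obtain \<phi> where fixpoint: "\<Phi> \<phi> = \<phi>"
    using banach_fix_type[of "L * (q - p)" \<Phi>] L pq by auto
  have eq: "apply_bcontfun \<phi> t = J \<phi> t" if "t \<in> {p..q}" for t
    using \<Phi>[of \<phi> t] that by (simp add: fixpoint c_def)
  have "(J \<phi> has_vector_derivative g (J \<phi> r)) (at r)" if "r \<in> {p<..<q}" for r
    using Jd[of r \<phi>] eq[of r] that
    by (auto simp: at_within_Icc_at)
  moreover have "J \<phi> p = y" by (simp add: J_def)
  ultimately show ?thesis using Jc by blast
qed

text \<open>The maximal distance \<open>D\<close> of the two solutions satisfies \<open>D \<le> L (q - p) D\<close>.\<close>

lemma lipschitz_ode_unique:
  fixes U V :: "real \<Rightarrow> 'v::real_normed_vector"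
  assumes pq: "p \<le> q" and lip: "\<And>x y. norm (g x - g y) \<le> L * norm (x - y)"
    and L: "0 \<le> L" "L * (q - p) < 1"
    and U: "continuous_on {p..q} U" "\<And>r. r \<in> {p<..<q} \<Longrightarrow> (U has_vector_derivative g (U r)) (at r)"
    and V: "continuous_on {p..q} V" "\<And>r. r \<in> {p<..<q} \<Longrightarrow> (V has_vector_derivative g (V r)) (at r)"
    and init: "U p = V p"
  shows "U q = V q"
proof -
  have "continuous_on {p..q} (\<lambda>t. norm (U t - V t))" using U V by (intro continuous_intros)
  then obtain m where m: "m \<in> {p..q}" "\<And>t. t \<in> {p..q} \<Longrightarrow> norm (U t - V t) \<le> norm (U m - V m)"
    using continuous_attains_sup[of "{p..q}" "\<lambda>t. norm (U t - V t)"] pq by auto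
  let ?D = "norm (U m - V m)"
  have "norm ((U m - V m) - (U p - V p)) \<le> (L * ?D) * (m - p)"
  proof (rule norm_increment_le[where f' = "\<lambda>r. g (U r) - g (V r)"])
    show "continuous_on {p..m} (\<lambda>t. U t - V t)"
      using U V m by (intro continuous_on_diff) (auto intro: continuous_on_subset)
    show "norm (g (U r) - g (V r)) \<le> L * ?D" if "r \<in> {p<..<m}" for r
      using lip[of "U r" "V r"] mult_left_mono[OF m(2)[of r] L(1)] that m(1) by auto
    show "((\<lambda>t. U t - V t) has_vector_derivative g (U r) - g (V r)) (at r)" if "r \<in> {p<..<m}" for r
      using U V m that by (intro has_vector_derivative_diff) auto
  qed (use m in auto)
  also have "\<dots> \<le> (L * ?D) * (q - p)"
    using m L by (intro mult_left_mono) auto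
  finally have "?D \<le> (L * (q - p)) * ?D" using init by (simp add: mult_ac)
  then have "(1 - L * (q - p)) * ?D \<le> 0" by (simp add: algebra_simps)
  then have "?D \<le> 0" using L by (simp add: mult_le_0_iff)
  then show ?thesis using m(2)[of q] pq by auto
qed

section \<open>The interpolated equation on a partition\<close>

lemma partition_nth_less:
  assumes "sorted_wrt (<) ts" "i < j" "j < length ts"
  shows "ts ! i < ts ! j"
  using assms sorted_wrt_nth_less by blast

lemma partition_nth_le:
  assumes "sorted_wrt (<) (ts :: real list)" "i \<le> j" "j < length ts"
  shows "ts ! i \<le> ts ! j"
  using assms partition_nth_less[of ts i j] by (cases "i = j") auto

text \<open>Solutions meeting at a grid point may be glued because the
  equation imposes no derivative there.\<close>

lemma partition_points_not_between:
  assumes "sorted_wrt (<) (ts :: real list)" "k < length ts" "n < length ts - 1"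
  shows "ts ! k \<notin> {ts ! n <..< ts ! Suc n}"
proof (cases "k \<le> n")
  case True
  moreover have "n < length ts" using assms by linarith
  ultimately show ?thesis using partition_nth_le[OF assms(1)] by force
next
  case False
  then have "Suc n \<le> k" by simp
  then show ?thesis using partition_nth_le[OF assms(1) _ assms(2)] by force
qed

text \<open>On a single step the equation has a constant slope, so it is one autonomous equation.\<close>

lemma wz_solution_step_iff:
  assumes "sorted_wrt (<) ts" "n < length ts - 1"
  shows "wz_solution F Z ts (ts ! n) (ts ! Suc n) U \<longleftrightarrow>
    continuous_on {ts ! n..ts ! Suc n} U \<and>
    (\<forall>r\<in>{ts ! n<..<ts ! Suc n}. (U has_vector_derivative
       (1 / (ts ! Suc n - ts ! n)) *\<^sub>R increment_field F (Z (ts ! Suc n) - Z (ts ! n)) (U r)) (at r))"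
proof -
  have n: "n < length ts" using assms by linarith
  \<comment> \<open>No other step of the partition overlaps with this one.\<close>
  have only: "{ts ! k <..< ts ! Suc k} \<inter> {ts ! n <..< ts ! Suc n} = {}" if "k < length ts - 1" "k \<noteq> n" for k
  proof (cases "k < n")
    case True
    then show ?thesis using partition_nth_le[OF assms(1) _ n, of "Suc k"] by auto
  next
    case False
    with that have "Suc n \<le> k" "k < length ts" by auto
    then show ?thesis using partition_nth_le[OF assms(1), of "Suc n" k] by auto
  qed
  have field: "(1 / (ts ! Suc k - ts ! k)) *\<^sub>R increment_field F (Z (ts ! Suc k) - Z (ts ! k)) u
     = (\<Sum>a\<in>UNIV. ((Z (ts ! Suc k) $ a - Z (ts ! k) $ a) / (ts ! Suc k - ts ! k)) *\<^sub>R F a u)" for k u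
    by (simp add: scaleR_sum_right)
  show ?thesis
    unfolding wz_solution_def field
  proof (intro conj_cong refl iffI ballI allI impI)
    fix r assume "\<forall>n'<length ts - 1. \<forall>r\<in>{ts ! n'<..<ts ! Suc n'} \<inter> {ts ! n<..<ts ! Suc n}.
      (U has_vector_derivative (\<Sum>a\<in>UNIV. ((Z (ts ! Suc n') $ a - Z (ts ! n') $ a)
        / (ts ! Suc n' - ts ! n')) *\<^sub>R F a (U r))) (at r)" "r \<in> {ts ! n<..<ts ! Suc n}"
    then show "(U has_vector_derivative (\<Sum>a\<in>UNIV. ((Z (ts ! Suc n) $ a - Z (ts ! n) $ a)
        / (ts ! Suc n - ts ! n)) *\<^sub>R F a (U r))) (at r)"
      using assms(2) by blast
  next
    fix k r assume "\<forall>r\<in>{ts ! n<..<ts ! Suc n}.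
      (U has_vector_derivative (\<Sum>a\<in>UNIV. ((Z (ts ! Suc n) $ a - Z (ts ! n) $ a)
        / (ts ! Suc n - ts ! n)) *\<^sub>R F a (U r))) (at r)" "k < length ts - 1"
      "r \<in> {ts ! k<..<ts ! Suc k} \<inter> {ts ! n<..<ts ! Suc n}"
    moreover from this only have "k = n" by blast
    ultimately show "(U has_vector_derivative (\<Sum>a\<in>UNIV. ((Z (ts ! Suc k) $ a - Z (ts ! k) $ a)
        / (ts ! Suc k - ts ! k)) *\<^sub>R F a (U r))) (at r)"
      by blast
  qed
qed

lemma wz_solution_restrict:
  assumes "wz_solution F Z ts s t U" "s \<le> s'" "t' \<le> t"
  shows "wz_solution F Z ts s' t' U"
  using assms unfolding wz_solution_def by (auto elim!: continuous_on_subset)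

lemma wz_solution_glue:
  assumes srt: "sorted_wrt (<) ts" and k: "k < length ts"
    and U: "wz_solution F Z ts s (ts ! k) U" and V: "wz_solution F Z ts (ts ! k) t V"
    and eq: "U (ts ! k) = V (ts ! k)" and le: "s \<le> ts ! k" "ts ! k \<le> t"
  shows "wz_solution F Z ts s t (\<lambda>r. if r \<le> ts ! k then U r else V r)" (is "wz_solution _ _ _ _ _ ?W")
proof -
  have "continuous_on ({s..ts ! k} \<union> {ts ! k..t}) ?W"
    using U V eq unfolding wz_solution_def by (intro continuous_on_cases) auto
  moreover have "{s..ts ! k} \<union> {ts ! k..t} = {s..t}" using le by auto
  ultimately have cont: "continuous_on {s..t} ?W" by simp
  have "(?W has_vector_derivative
      (\<Sum>a\<in>UNIV. ((Z (ts ! Suc n) $ a - Z (ts ! n) $ a) / (ts ! Suc n - ts ! n)) *\<^sub>R F a (?W r))) (at r)"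
    if n: "n < length ts - 1" and r: "r \<in> {ts ! n <..< ts ! Suc n} \<inter> {s<..<t}" for n r
  proof -
    have "r \<noteq> ts ! k" using partition_points_not_between[OF srt k n] r by auto
    then consider "r < ts ! k" | "ts ! k < r" by linarith
    then show ?thesis
    proof cases
      case 1
      then have "r \<in> {ts ! n <..< ts ! Suc n} \<inter> {s<..<ts ! k}" using r by auto
      with U n have d: "(U has_vector_derivative
        (\<Sum>a\<in>UNIV. ((Z (ts ! Suc n) $ a - Z (ts ! n) $ a) / (ts ! Suc n - ts ! n)) *\<^sub>R F a (U r))) (at r)"
        unfolding wz_solution_def by blast
      show ?thesis
        using has_vector_derivative_transform_within_open[OF d, of "{..<ts ! k}" ?W] 1 by simp
    next
      case 2
      then have "r \<in> {ts ! n <..< ts ! Suc n} \<inter> {ts ! k<..<t}" using r by auto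
      with V n have d: "(V has_vector_derivative
        (\<Sum>a\<in>UNIV. ((Z (ts ! Suc n) $ a - Z (ts ! n) $ a) / (ts ! Suc n - ts ! n)) *\<^sub>R F a (V r))) (at r)"
        unfolding wz_solution_def by blast
      show ?thesis
        using has_vector_derivative_transform_within_open[OF d, of "{ts ! k<..}" ?W] 2 by simp
    qed
  qed
  with cont show ?thesis unfolding wz_solution_def by blast
qed

text \<open>In this situation the equation is uniquely solvable step by step.
  The field in the condition has not been divided by the length of the step: over the step the
  slope acts for exactly that length, so this is the contraction constant of Picard's operator.\<close>

locale contractive_partition =
  fixes F :: "'m::finite \<Rightarrow> real^'e \<Rightarrow> real^'e" and Z :: "real \<Rightarrow> real^'m" and ts :: "real list"
  assumes srt: "sorted_wrt (<) ts"
    and contractive: "\<And>n. n < length ts - 1 \<Longrightarrow> \<exists>L. 0 \<le> L \<and> L < 1 \<and>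
      (\<forall>u v. norm (increment_field F (Z (ts ! Suc n) - Z (ts ! n)) u
               - increment_field F (Z (ts ! Suc n) - Z (ts ! n)) v) \<le> L * norm (u - v))"
begin

lemma step_lipschitz:
  assumes n: "n < length ts - 1"
  obtains L where "0 \<le> L" "L * (ts ! Suc n - ts ! n) < 1"
    "\<And>u v. norm ((1 / (ts ! Suc n - ts ! n)) *\<^sub>R increment_field F (Z (ts ! Suc n) - Z (ts ! n)) u
       - (1 / (ts ! Suc n - ts ! n)) *\<^sub>R increment_field F (Z (ts ! Suc n) - Z (ts ! n)) v)
       \<le> L * norm (u - v)"
proof -
  obtain L where L: "0 \<le> L" "L < 1" "\<And>u v. norm (increment_field F (Z (ts ! Suc n) - Z (ts ! n)) u
      - increment_field F (Z (ts ! Suc n) - Z (ts ! n)) v) \<le> L * norm (u - v)"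
    using contractive[OF n] by blast
  have h: "0 < ts ! Suc n - ts ! n" using partition_nth_less[OF srt, of n "Suc n"] n by simp
  show thesis
  proof (rule that[of "L / (ts ! Suc n - ts ! n)"])
    show "0 \<le> L / (ts ! Suc n - ts ! n)" "L / (ts ! Suc n - ts ! n) * (ts ! Suc n - ts ! n) < 1"
      using L h by auto
    fix u v
    show "norm ((1 / (ts ! Suc n - ts ! n)) *\<^sub>R increment_field F (Z (ts ! Suc n) - Z (ts ! n)) u
       - (1 / (ts ! Suc n - ts ! n)) *\<^sub>R increment_field F (Z (ts ! Suc n) - Z (ts ! n)) v)
       \<le> L / (ts ! Suc n - ts ! n) * norm (u - v)"
      using L(3)[of u v] h unfolding scaleR_diff_right[symmetric] norm_scaleR
      by (simp add: divide_right_mono)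
  qed
qed

lemma wz_solution_exists:
  assumes "i \<le> j" "j < length ts"
  shows "\<exists>U. wz_solution F Z ts (ts ! i) (ts ! j) U \<and> U (ts ! i) = y"
  using assms
proof (induction rule: dec_induct)
  case base
  show ?case by (intro exI[of _ "\<lambda>_. y"]) (simp add: wz_solution_def)
next
  case (step n)
  then obtain U where U: "wz_solution F Z ts (ts ! i) (ts ! n) U" "U (ts ! i) = y" by auto
  have n: "n < length ts - 1" using step by simp
  have le: "ts ! i \<le> ts ! n" "ts ! n \<le> ts ! Suc n"
    using partition_nth_le[OF srt] step by auto
  obtain L where L: "0 \<le> L" "L * (ts ! Suc n - ts ! n) < 1"
    "\<And>u v. norm ((1 / (ts ! Suc n - ts ! n)) *\<^sub>R increment_field F (Z (ts ! Suc n) - Z (ts ! n)) u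
       - (1 / (ts ! Suc n - ts ! n)) *\<^sub>R increment_field F (Z (ts ! Suc n) - Z (ts ! n)) v)
       \<le> L * norm (u - v)"
    using step_lipschitz[OF n] by blast
  obtain V where "wz_solution F Z ts (ts ! n) (ts ! Suc n) V" "V (ts ! n) = U (ts ! n)"
    using lipschitz_ode_exists[OF le(2) L(3,1,2), of "U (ts ! n)"]
    unfolding wz_solution_step_iff[OF srt n] by blast
  then have "wz_solution F Z ts (ts ! i) (ts ! Suc n) (\<lambda>r. if r \<le> ts ! n then U r else V r)"
    using U le n by (intro wz_solution_glue[OF srt]) auto
  then show ?case
    using U(2) le(1) by (intro exI[of _ "\<lambda>r. if r \<le> ts ! n then U r else V r"]) auto
qed

lemma wz_solution_unique:
  assumes "i \<le> j" "j < length ts" "wz_solution F Z ts (ts ! i) (ts ! j) U"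
    "wz_solution F Z ts (ts ! i) (ts ! j) V" "U (ts ! i) = V (ts ! i)"
  shows "U (ts ! j) = V (ts ! j)"
  using assms
proof (induction rule: dec_induct)
  case base
  then show ?case by simp
next
  case (step n)
  have n: "n < length ts - 1" using step by simp
  have le: "ts ! i \<le> ts ! n" "ts ! n \<le> ts ! Suc n"
    using partition_nth_le[OF srt] step by auto
  have "wz_solution F Z ts (ts ! i) (ts ! n) U" "wz_solution F Z ts (ts ! i) (ts ! n) V"
    using wz_solution_restrict[OF _ order_refl le(2)] step.prems by blast+
  then have eq: "U (ts ! n) = V (ts ! n)"
    using step by simp
  have "wz_solution F Z ts (ts ! n) (ts ! Suc n) U" "wz_solution F Z ts (ts ! n) (ts ! Suc n) V"
    using step le wz_solution_restrict[OF _ le(1) order_refl] by auto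
  note UV = this[unfolded wz_solution_step_iff[OF srt n]]
  obtain L where L: "0 \<le> L" "L * (ts ! Suc n - ts ! n) < 1"
    "\<And>u v. norm ((1 / (ts ! Suc n - ts ! n)) *\<^sub>R increment_field F (Z (ts ! Suc n) - Z (ts ! n)) u
       - (1 / (ts ! Suc n - ts ! n)) *\<^sub>R increment_field F (Z (ts ! Suc n) - Z (ts ! n)) v)
       \<le> L * norm (u - v)"
    using step_lipschitz[OF n] by blast
  show ?case
    by (rule lipschitz_ode_unique[OF le(2) L(3,1,2)]) (use UV eq in auto)
qed

lemma wz_flow_eq:
  assumes "i \<le> j" "j < length ts" "wz_solution F Z ts (ts ! i) (ts ! j) U"
  shows "wz_flow F Z ts (ts ! i) (ts ! j) (U (ts ! i)) = U (ts ! j)"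
  unfolding wz_flow_def using assms wz_solution_unique by (intro the_equality) blast+

lemma wz_flow_refl: "i < length ts \<Longrightarrow> wz_flow F Z ts (ts ! i) (ts ! i) y = y"
  using wz_flow_eq[of i i "\<lambda>_. y"] by (simp add: wz_solution_def)

lemma wz_flow_compose:
  assumes "i \<le> j" "j \<le> k" "k < length ts"
  shows "wz_flow F Z ts (ts ! j) (ts ! k) (wz_flow F Z ts (ts ! i) (ts ! j) y)
    = wz_flow F Z ts (ts ! i) (ts ! k) y"
proof -
  obtain U where U: "wz_solution F Z ts (ts ! i) (ts ! k) U" "U (ts ! i) = y"
    using wz_solution_exists[of i k y] assms by auto
  have le: "ts ! i \<le> ts ! j" "ts ! j \<le> ts ! k"
    using partition_nth_le[OF srt] assms by auto
  have "wz_solution F Z ts (ts ! i) (ts ! j) U" "wz_solution F Z ts (ts ! j) (ts ! k) U"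
    using wz_solution_restrict[OF U(1)] le by auto
  then show ?thesis
    using wz_flow_eq[of i j U] wz_flow_eq[of j k U] wz_flow_eq[of i k U] assms U by auto
qed

end

section \<open>Local and global error of the Runge--Kutta method\<close>

text \<open>After rescaling to \<open>[0,1]\<close> the flow and the method have the same third-order expansion
  with \<open>\<kappa> = B |x|\<close>, so they differ by \<open>O(|x|\<^sup>4)\<close>. The constant depends on the vector fields only
  through \<open>B\<close>, hence it serves all partitions and all steps.\<close>

lemma local_error:
  fixes F :: "'m::finite \<Rightarrow> real^'e \<Rightarrow> real^'e" and A :: "real^'q^'q" and b :: "real^'q"
    and B :: real
  assumes field: "\<forall>x::real^'m. \<exists>G1 G2 G3. bounded_C3_field (increment_field F x) G1 G2 G3 (B * norm x)"
    and order: "third_order_conditions A b"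
  shows "\<exists>C>0. \<forall>Z ts n U k.
      sorted_wrt (<) ts \<longrightarrow> n < length ts - 1 \<longrightarrow> B * norm (Z (ts ! Suc n) - Z (ts ! n)) \<le> 1 \<longrightarrow>
      wz_solution F Z ts (ts ! n) (ts ! Suc n) U \<longrightarrow>
      scrk_stages F Z A (ts ! n) (ts ! Suc n) (U (ts ! n)) k \<longrightarrow>
      norm (U (ts ! Suc n) - (U (ts ! n) + (\<Sum>a\<in>UNIV. \<Sum>i\<in>UNIV.
          (b $ i * (Z (ts ! Suc n) $ a - Z (ts ! n) $ a)) *\<^sub>R F a (k i))))
        \<le> C * norm (Z (ts ! Suc n) - Z (ts ! n)) ^ 4"
proof -
  define M where "M = 1 + (\<Sum>i\<in>UNIV. \<bar>b $ i\<bar>) + (\<Sum>i\<in>UNIV. \<Sum>j\<in>UNIV. \<bar>A $ i $ j\<bar>)"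
  define N where "N = M * (4 * M^4 + M^2)"
  have M1: "1 \<le> M" by (simp add: M_def sum_nonneg)
  have bM: "(\<Sum>i\<in>UNIV. \<bar>b $ i\<bar>) \<le> M" by (simp add: M_def sum_nonneg)
  have AM: "(\<Sum>j\<in>UNIV. \<bar>A $ i $ j\<bar>) \<le> M" for i
  proof -
    have "(\<Sum>j\<in>UNIV. \<bar>A $ i $ j\<bar>) \<le> (\<Sum>i\<in>UNIV. \<Sum>j\<in>UNIV. \<bar>A $ i $ j\<bar>)"
      by (rule member_le_sum[of i UNIV "\<lambda>i. \<Sum>j\<in>UNIV. \<bar>A $ i $ j\<bar>"]) (auto intro: sum_nonneg)
    moreover have "0 \<le> (\<Sum>i\<in>UNIV. \<bar>b $ i\<bar>)" by (simp add: sum_nonneg)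
    ultimately show ?thesis unfolding M_def by linarith
  qed
  define C where "C = (3480 + M * (27 * N^3 + 4 * N^2 + N)) * B^4"
  show ?thesis
  proof (intro exI[of _ "\<bar>C\<bar> + 1"] conjI allI impI)
    fix Z :: "real \<Rightarrow> real^'m" and ts n U k
    assume srt: "sorted_wrt (<) ts" and n: "n < length ts - 1"
      and small: "B * norm (Z (ts ! Suc n) - Z (ts ! n)) \<le> 1"
      and U: "wz_solution F Z ts (ts ! n) (ts ! Suc n) U"
      and stages: "scrk_stages F Z A (ts ! n) (ts ! Suc n) (U (ts ! n)) k"
    define x where "x = Z (ts ! Suc n) - Z (ts ! n)"
    define p where "p = ts ! n"
    define \<tau> where "\<tau> = ts ! Suc n - ts ! n"
    have \<tau>: "0 < \<tau>" using partition_nth_less[OF srt, of n "Suc n"] n by (simp add: \<tau>_def)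
    obtain G1 G2 G3 where "bounded_C3_field (increment_field F x) G1 G2 G3 (B * norm x)"
      using field by blast
    then interpret bounded_C3_field "increment_field F x" G1 G2 G3 "B * norm x" .
    have U': "continuous_on {p..p + \<tau>} U"
      "\<And>r. r \<in> {p<..<p + \<tau>} \<Longrightarrow> (U has_vector_derivative (1 / \<tau>) *\<^sub>R increment_field F x (U r)) (at r)"
      using U unfolding wz_solution_step_iff[OF srt n] x_def p_def \<tau>_def by auto
    define u where "u s = U (p + s * \<tau>)" for s
    have flow: "norm (u 1 - third_order_step (U p)) \<le> 3480 * (B * norm x)^4"
    proof (rule exact_flow_expansion)
      show "continuous_on {0..1} u"
        unfolding u_def using \<tau>
        by (intro continuous_on_compose2[OF U'(1)])
           (auto intro!: continuous_intros simp: mult_left_le_one_le)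
      fix s :: real assume s: "s \<in> {0<..<1}"
      then have "p + s * \<tau> \<in> {p<..<p + \<tau>}" using \<tau> by auto
      note dU = U'(2)[OF this]
      have "((\<lambda>s. p + s * \<tau>) has_vector_derivative \<tau>) (at s)"
        by (auto intro!: derivative_eq_intros simp: has_vector_derivative_def)
      from vector_diff_chain_at[OF this dU]
      show "(u has_vector_derivative increment_field F x (u s)) (at s)"
        using \<tau> by (simp add: u_def[abs_def] o_def)
    qed (use small in \<open>auto simp: u_def x_def\<close>)
    have regroup: "(\<Sum>a\<in>UNIV. \<Sum>j\<in>UNIV. (w j * (Z (ts ! Suc n) $ a - Z (ts ! n) $ a)) *\<^sub>R F a (k j))
      = (\<Sum>j\<in>UNIV. w j *\<^sub>R increment_field F x (k j))" for w :: "'q \<Rightarrow> real"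
      by (subst sum.swap) (simp add: x_def scaleR_sum_right)
    have "norm (U p + (\<Sum>i\<in>UNIV. b $ i *\<^sub>R increment_field F x (k i)) - third_order_step (U p))
        \<le> M * ((27 * N^3 + 4 * N^2 + N) * (B * norm x)^4)"
    proof (rule runge_kutta_expansion[OF order _ AM bM M1 N_def])
      show "k i = U p + (\<Sum>j\<in>UNIV. A $ i $ j *\<^sub>R increment_field F x (k j))" for i
        using stages unfolding scrk_stages_def regroup[symmetric] p_def by blast
      show "B * norm x \<le> 1" using small by (simp add: x_def)
    qed
    then have rk: "norm (third_order_step (U p) - (U p + (\<Sum>i\<in>UNIV. b $ i *\<^sub>R increment_field F x (k i))))
        \<le> M * ((27 * N^3 + 4 * N^2 + N) * (B * norm x)^4)"
      by (subst norm_minus_commute)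
    have "norm (u 1 - (U p + (\<Sum>i\<in>UNIV. b $ i *\<^sub>R increment_field F x (k i))))
        \<le> 3480 * (B * norm x)^4 + M * ((27 * N^3 + 4 * N^2 + N) * (B * norm x)^4)"
      by (rule norm_diff_triangle_le[OF flow rk])
    also have "\<dots> = C * norm x ^ 4"
      by (simp add: C_def power_mult_distrib algebra_simps)
    also have "\<dots> \<le> (\<bar>C\<bar> + 1) * norm x ^ 4" by (intro mult_right_mono) auto
    finally show "norm (U (ts ! Suc n) - (U (ts ! n) + (\<Sum>a\<in>UNIV. \<Sum>i\<in>UNIV.
            (b $ i * (Z (ts ! Suc n) $ a - Z (ts ! n) $ a)) *\<^sub>R F a (k i))))
       \<le> (\<bar>C\<bar> + 1) * norm (Z (ts ! Suc n) - Z (ts ! n)) ^ 4"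
      unfolding regroup by (simp add: u_def p_def \<tau>_def x_def)
  qed simp
qed

text \<open>Lady Windermere's fan: \<open>\<phi> n\<close> follows the method up to time \<open>t\<^sub>n\<close> and the exact flow from then on.
  Consecutive values differ by one local error transported by the flow, and the differences
  telescope.\<close>

lemma (in contractive_partition) one_step_global_error:
  assumes N: "N < length ts" and L: "0 \<le> L"
    and lip: "\<And>n u v. \<lbrakk>n \<le> N; u \<in> S; v \<in> S\<rbrakk> \<Longrightarrow>
      norm (wz_flow F Z ts (ts ! n) (ts ! N) u - wz_flow F Z ts (ts ! n) (ts ! N) v) \<le> L * norm (u - v)"
    and S: "\<And>n. n < N \<Longrightarrow> wz_flow F Z ts (ts ! n) (ts ! Suc n) (y n) \<in> S" "\<And>n. n < N \<Longrightarrow> y (Suc n) \<in> S"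
    and err: "\<And>n. n < N \<Longrightarrow> norm (wz_flow F Z ts (ts ! n) (ts ! Suc n) (y n) - y (Suc n)) \<le> \<epsilon> n"
  shows "norm (wz_flow F Z ts (ts ! 0) (ts ! N) (y 0) - y N) \<le> L * (\<Sum>n<N. \<epsilon> n)"
proof -
  define \<phi> where "\<phi> n = wz_flow F Z ts (ts ! n) (ts ! N) (y n)" for n
  have "norm (\<phi> n - \<phi> (Suc n)) \<le> L * \<epsilon> n" if "n < N" for n
  proof -
    have "\<phi> n = wz_flow F Z ts (ts ! Suc n) (ts ! N) (wz_flow F Z ts (ts ! n) (ts ! Suc n) (y n))"
      using wz_flow_compose[of n "Suc n" N] that N by (simp add: \<phi>_def)
    then have "norm (\<phi> n - \<phi> (Suc n)) \<le> L * norm (wz_flow F Z ts (ts ! n) (ts ! Suc n) (y n) - y (Suc n))"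
      using lip[of "Suc n"] S that by (simp add: \<phi>_def)
    also have "\<dots> \<le> L * \<epsilon> n" using err that L by (intro mult_left_mono)
    finally show ?thesis .
  qed
  then have "norm (\<Sum>n<N. \<phi> n - \<phi> (Suc n)) \<le> (\<Sum>n<N. L * \<epsilon> n)"
    by (intro sum_norm_le) auto
  moreover have "(\<Sum>n<N. \<phi> n - \<phi> (Suc n)) = \<phi> 0 - y N"
    using wz_flow_refl[OF N] by (simp only: sum_lessThan_telescope' \<phi>_def[of N])
  ultimately show ?thesis by (simp add: \<phi>_def sum_distrib_left)
qed

lemma mesh_ge_step: "n < length ts - 1 \<Longrightarrow> ts ! Suc n - ts ! n \<le> mesh ts"
  unfolding mesh_def by (intro Max_ge) auto

lemma partition_of_facts:
  assumes "partition_of a b ts" "a < b"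
  shows "sorted_wrt (<) ts" "ts ! 0 = a" "ts ! (length ts - 1) = b" "1 < length ts" "0 < mesh ts"
    "\<And>n. n < length ts \<Longrightarrow> ts ! n \<in> {a..b}"
proof -
  show srt: "sorted_wrt (<) ts" and a: "ts ! 0 = a" and b: "ts ! (length ts - 1) = b"
    using assms unfolding partition_of_def by (auto simp: hd_conv_nth last_conv_nth)
  have "length ts \<noteq> 0" using assms unfolding partition_of_def by auto
  moreover have "length ts \<noteq> 1" using a b assms(2) by auto
  ultimately show len: "1 < length ts" by linarith
  then have "ts ! 0 < ts ! Suc 0" by (intro partition_nth_less[OF srt]) auto
  then show "0 < mesh ts" using mesh_ge_step[of 0 ts] len by auto
  show "ts ! n \<in> {a..b}" if "n < length ts" for n
    using partition_nth_le[OF srt, of 0 n] partition_nth_le[OF srt, of n "length ts - 1"] that a b by auto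
qed

theorem corollary6p7:
  fixes T \<alpha> C\<^sub>W\<^sub>Z r\<^sub>0 h\<^sub>0 R :: real
    and X :: "real \<Rightarrow> real^'d" and XX :: "real \<Rightarrow> real \<Rightarrow> real^'d^'d"
    and Z :: "real \<Rightarrow> real^'m" and Z' :: "real \<Rightarrow> (real^'d) \<Rightarrow>\<^sub>L (real^'m)"
    and F :: "'m \<Rightarrow> real^'e \<Rightarrow> real^'e"
    and Y :: "real \<Rightarrow> real^'e" and Y' :: "real \<Rightarrow> (real^'d) \<Rightarrow>\<^sub>L (real^'e)"
    and A :: "real^'q^'q" and b :: "real^'q"
    and K :: "real \<Rightarrow> real \<Rightarrow> real^'e \<Rightarrow> 'q \<Rightarrow> real^'e"
    and P :: "real list set"
  assumes T: "T > 0"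
    and alpha: "1 / 3 < \<alpha>" "\<alpha> \<le> 1 / 2"
    and X: "rough_path T \<alpha> X XX"
    and Z: "controlled_path T \<alpha> X Z Z'"
    and F: "\<And>a. Cb4 (F a)"
    and Y: "rde_solution T \<alpha> X XX Z Z' F Y Y'"
    and P: "\<And>ts. ts \<in> P \<Longrightarrow> partition_of 0 T ts"
    and wz_pos: "C\<^sub>W\<^sub>Z > 0" "r\<^sub>0 > 0" "h\<^sub>0 > 0"
    and wz: "\<And>ts Yh t. \<lbrakk>ts \<in> P; 0 < mesh ts; mesh ts \<le> h\<^sub>0;
                wz_solution F Z ts 0 T Yh; Yh 0 = Y 0; t \<in> {0..T}\<rbrakk>
              \<Longrightarrow> norm (Y t - Yh t) \<le> C\<^sub>W\<^sub>Z * mesh ts powr r\<^sub>0"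
    and stages: "\<And>ts n. \<lbrakk>ts \<in> P; n < length ts - 1\<rbrakk> \<Longrightarrow>
              (let y = scrk_seq F Z b K ts (Y 0) n
               in scrk_stages F Z A (ts ! n) (ts ! Suc n) y (K (ts ! n) (ts ! Suc n) y))"
    and order: "third_order_conditions A b"
    and flow_lipschitz: "\<And>R'. R' > 0 \<Longrightarrow>
              \<exists>L>0. \<forall>ts\<in>P. \<forall>y\<in>cball 0 R'. \<forall>y'\<in>cball 0 R'. \<forall>s t. 0 \<le> s \<and> s \<le> t \<and> t \<le> T \<longrightarrow>
                norm (wz_flow F Z ts s t y - wz_flow F Z ts s t y') \<le> L * norm (y - y')"
    and R: "R > 0"
    and in_ball: "\<And>ts n. \<lbrakk>ts \<in> P; n < length ts - 1\<rbrakk> \<Longrightarrow>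
              (let y = scrk_seq F Z b K ts (Y 0) n
               in y \<in> cball 0 R \<and>
                  wz_flow F Z ts (ts ! n) (ts ! Suc n) y \<in> cball 0 R \<and>
                  scrk_step F Z b K (ts ! n) (ts ! Suc n) y \<in> cball 0 R)"
  shows "\<exists>C>0. \<forall>ts\<in>P.
           Max ((\<lambda>n. norm (Y (ts ! n) - scrk_seq F Z b K ts (Y 0) n)) ` {..length ts - 1})
             \<le> C * mesh ts powr min r\<^sub>0 (4 * \<alpha> - 1)"
proof -
  obtain CZ0 where CZ0: "\<And>s t. s \<in> {0..T} \<Longrightarrow> t \<in> {0..T} \<Longrightarrow> norm (Z t - Z s) \<le> CZ0 * \<bar>t - s\<bar> powr \<alpha>"
    using Z unfolding controlled_path_def hoelder_on_def by blast
  define CZ where "CZ = \<bar>CZ0\<bar> + 1"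
  have CZ: "CZ > 0" by (simp add: CZ_def)
  have hoelder_Z: "norm (Z t - Z s) \<le> CZ * \<bar>t - s\<bar> powr \<alpha>"
    if "s \<in> {0..T}" "t \<in> {0..T}" for s t
  proof -
    have "CZ0 * \<bar>t - s\<bar> powr \<alpha> \<le> CZ * \<bar>t - s\<bar> powr \<alpha>"
      unfolding CZ_def by (intro mult_right_mono) auto
    then show ?thesis using CZ0[OF that] by linarith
  qed
  obtain CY where CY: "\<And>s t. s \<in> {0..T} \<Longrightarrow> t \<in> {0..T} \<Longrightarrow> norm (Y t - Y s) \<le> CY * \<bar>t - s\<bar> powr \<alpha>"
    using Y unfolding rde_solution_def controlled_path_def hoelder_on_def by blast
  \<comment> \<open>An a priori bound of the error, used for a mesh above the threshold \<open>h\<^sub>1\<close>.\<close>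
  define D where "D = \<bar>CY\<bar> * T powr \<alpha> + norm (Y 0) + R"
  have D: "D > 0" using R by (simp add: D_def add_nonneg_pos)
  obtain B where B: "B > 0"
    and field: "\<forall>x::real^'m. \<exists>G1 G2 G3. bounded_C3_field (increment_field F x) G1 G2 G3 (B * norm x)"
    using increment_field_bounded_C3[of F, OF F] by (elim exE conjE) (rule that; assumption)
  obtain C1 where C1: "C1 > 0" and local_err: "\<forall>Z ts n U k.
      sorted_wrt (<) ts \<longrightarrow> n < length ts - 1 \<longrightarrow> B * norm (Z (ts ! Suc n) - Z (ts ! n)) \<le> 1 \<longrightarrow>
      wz_solution F Z ts (ts ! n) (ts ! Suc n) U \<longrightarrow>
      scrk_stages F Z A (ts ! n) (ts ! Suc n) (U (ts ! n)) k \<longrightarrow>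
      norm (U (ts ! Suc n) - (U (ts ! n) + (\<Sum>a\<in>UNIV. \<Sum>i\<in>UNIV.
          (b $ i * (Z (ts ! Suc n) $ a - Z (ts ! n) $ a)) *\<^sub>R F a (k i))))
        \<le> C1 * norm (Z (ts ! Suc n) - Z (ts ! n)) ^ 4"
    using local_error[OF field order] by (elim exE conjE) (rule that; assumption)
  obtain L where L: "L > 0" and lip: "\<And>ts u v s t. \<lbrakk>ts \<in> P; u \<in> cball 0 R; v \<in> cball 0 R; 0 \<le> s; s \<le> t; t \<le> T\<rbrakk>
      \<Longrightarrow> norm (wz_flow F Z ts s t u - wz_flow F Z ts s t v) \<le> L * norm (u - v)"
    using flow_lipschitz[OF R] by blast
  define p where "p = min r\<^sub>0 (4 * \<alpha> - 1)"
  \<comment> \<open>Below \<open>h\<^sub>1\<close> the hypothesis on the interpolated equation applies, every step is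
     contractive, and the smaller of the two exponents gives the larger power of the mesh.\<close>
  define h\<^sub>1 where "h\<^sub>1 = min (min 1 h\<^sub>0) ((1 / (2 * B * CZ)) powr (1 / \<alpha>))"
  have h1: "h\<^sub>1 > 0" "h\<^sub>1 \<le> 1" "h\<^sub>1 \<le> h\<^sub>0" using wz_pos B CZ T by (auto simp: h\<^sub>1_def)
  have p: "p > 0" using wz_pos alpha by (simp add: p_def)
  have small_steps: "B * (CZ * h powr \<alpha>) \<le> 1 / 2" if "0 \<le> h" "h \<le> h\<^sub>1" for h
  proof -
    have "h powr \<alpha> \<le> ((1 / (2 * B * CZ)) powr (1 / \<alpha>)) powr \<alpha>"
      using that alpha by (intro powr_mono2) (auto simp: h\<^sub>1_def)
    also have "\<dots> = 1 / (2 * B * CZ)" using alpha B CZ T by (simp add: powr_powr)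
    finally have "(B * CZ) * h powr \<alpha> \<le> (B * CZ) * (1 / (2 * B * CZ))"
      using B CZ T by (intro mult_left_mono) auto
    then show ?thesis using B CZ T by (simp add: mult.assoc)
  qed
  define Cfin where "Cfin = D / h\<^sub>1 powr p + C\<^sub>W\<^sub>Z + L * (C1 * CZ^4 * T)"
  have pos: "0 < D / h\<^sub>1 powr p" "0 < L * (C1 * CZ^4 * T)" using D h1 L C1 CZ T by auto
  have main: "norm (Y (ts ! N) - scrk_seq F Z b K ts (Y 0) N) \<le> Cfin * mesh ts powr p"
    if ts: "ts \<in> P" and N: "N \<le> length ts - 1" for ts N
  proof -
    note facts = partition_of_facts[OF P[OF ts] T]
    define h where "h = mesh ts"
    define y where "y n = scrk_seq F Z b K ts (Y 0) n" for n
    have h: "h > 0" using facts by (simp add: h_def)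
    have Nlen: "N < length ts" using N facts(4) by linarith
    have hp: "0 \<le> h powr p" by simp
    show ?thesis
    proof (cases "h \<le> h\<^sub>1")
      case False
      have "y N \<in> cball 0 R"
      proof (cases N)
        case 0
        then show ?thesis using in_ball[OF ts, of 0] facts(4) by (simp add: y_def Let_def)
      next
        case (Suc n)
        then show ?thesis using in_ball[OF ts, of n] N by (simp add: y_def Let_def)
      qed
      then have yN: "norm (y N) \<le> R" by simp
      have "norm (Y (ts ! N) - Y 0) \<le> CY * \<bar>ts ! N - 0\<bar> powr \<alpha>"
        using facts(6)[OF Nlen] T by (intro CY) auto
      also have "\<dots> \<le> \<bar>CY\<bar> * T powr \<alpha>"
        using facts(6)[OF Nlen] alpha by (intro mult_mono powr_mono2) auto
      finally have "norm (Y (ts ! N)) \<le> \<bar>CY\<bar> * T powr \<alpha> + norm (Y 0)"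
        using norm_triangle_sub[of "Y (ts ! N)" "Y 0"] by linarith
      then have "norm (Y (ts ! N) - y N) \<le> D"
        using norm_triangle_ineq4[of "Y (ts ! N)" "y N"] yN by (simp add: D_def)
      also have "D = D / h\<^sub>1 powr p * h\<^sub>1 powr p" using h1 by simp
      also have "\<dots> \<le> D / h\<^sub>1 powr p * h powr p"
        using False h1 pos p by (intro mult_left_mono powr_mono2) auto
      also have "\<dots> \<le> Cfin * h powr p"
        using pos wz_pos hp by (intro mult_right_mono) (auto simp: Cfin_def)
      finally show ?thesis by (simp add: h_def y_def)
    next
      case True
      have step: "0 < ts ! Suc n - ts ! n" "ts ! Suc n - ts ! n \<le> h"
        "norm (Z (ts ! Suc n) - Z (ts ! n)) \<le> CZ * (ts ! Suc n - ts ! n) powr \<alpha>"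
        "B * norm (Z (ts ! Suc n) - Z (ts ! n)) \<le> 1 / 2" if n: "n < length ts - 1" for n
      proof -
        show pos_n: "0 < ts ! Suc n - ts ! n"
          using partition_nth_less[OF facts(1), of n "Suc n"] n by simp
        show le_n: "ts ! Suc n - ts ! n \<le> h" using mesh_ge_step[OF n] by (simp add: h_def)
        show Z_n: "norm (Z (ts ! Suc n) - Z (ts ! n)) \<le> CZ * (ts ! Suc n - ts ! n) powr \<alpha>"
          using hoelder_Z[OF facts(6) facts(6), of n "Suc n"] n pos_n by simp
        have "B * norm (Z (ts ! Suc n) - Z (ts ! n)) \<le> B * (CZ * (ts ! Suc n - ts ! n) powr \<alpha>)"
          using Z_n B by (intro mult_left_mono) auto
        also have "\<dots> \<le> 1 / 2" using pos_n le_n True by (intro small_steps) auto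
        finally show "B * norm (Z (ts ! Suc n) - Z (ts ! n)) \<le> 1 / 2" .
      qed
      interpret contractive_partition F Z ts
      proof
        show "sorted_wrt (<) ts" by (rule facts)
        fix n assume n: "n < length ts - 1"
        obtain G1 G2 G3 where "bounded_C3_field (increment_field F (Z (ts ! Suc n) - Z (ts ! n))) G1 G2 G3
            (B * norm (Z (ts ! Suc n) - Z (ts ! n)))"
          using field by blast
        from bounded_C3_field.G_lipschitz[OF this] step(4)[OF n] B
        show "\<exists>L. 0 \<le> L \<and> L < 1 \<and>
          (\<forall>u v. norm (increment_field F (Z (ts ! Suc n) - Z (ts ! n)) u
               - increment_field F (Z (ts ! Suc n) - Z (ts ! n)) v) \<le> L * norm (u - v))"
          by (intro exI[of _ "B * norm (Z (ts ! Suc n) - Z (ts ! n))"]) auto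
      qed
      have step_err: "norm (wz_flow F Z ts (ts ! n) (ts ! Suc n) (y n) - y (Suc n))
          \<le> C1 * CZ^4 * h powr (4 * \<alpha> - 1) * (ts ! Suc n - ts ! n)" if n: "n < length ts - 1" for n
      proof -
        have len: "Suc n < length ts" using n by simp
        obtain U where U: "wz_solution F Z ts (ts ! n) (ts ! Suc n) U" "U (ts ! n) = y n"
          using wz_solution_exists[of n "Suc n"] len by auto
        define \<tau> where "\<tau> = ts ! Suc n - ts ! n"
        have \<tau>: "0 < \<tau>" "\<tau> \<le> h" using step[OF n] by (auto simp: \<tau>_def)
        have "scrk_stages F Z A (ts ! n) (ts ! Suc n) (U (ts ! n)) (K (ts ! n) (ts ! Suc n) (y n))"
          using stages[OF ts n] U(2) by (simp add: Let_def y_def)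
        from local_err[rule_format, OF facts(1) n _ U(1) this] step(4)[OF n]
        have "norm (U (ts ! Suc n) - y (Suc n)) \<le> C1 * norm (Z (ts ! Suc n) - Z (ts ! n)) ^ 4"
          using U(2) by (simp add: y_def scrk_step_def)
        also have "\<dots> \<le> C1 * (CZ * \<tau> powr \<alpha>) ^ 4"
          using step(3)[OF n] C1 by (intro mult_left_mono power_mono) (auto simp: \<tau>_def)
        also have "\<dots> = C1 * CZ^4 * (\<tau> powr (4 * \<alpha> - 1) * \<tau>)"
        proof -
          have "(\<tau> powr \<alpha>) ^ 4 = \<tau> powr (4 * \<alpha>)" by (simp add: power4_eq_xxxx flip: powr_add)
          also have "\<dots> = \<tau> powr (4 * \<alpha> - 1) * \<tau>" using \<tau> by (simp add: powr_diff)
          finally show ?thesis by (simp add: power_mult_distrib)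
        qed
        also have "\<dots> \<le> C1 * CZ^4 * (h powr (4 * \<alpha> - 1) * \<tau>)"
          using \<tau> alpha C1 CZ T by (intro mult_left_mono mult_right_mono powr_mono2) auto
        finally show ?thesis
          using wz_flow_eq[OF _ len U(1)] U(2) by (simp add: \<tau>_def mult.assoc)
      qed
      have "norm (wz_flow F Z ts (ts ! 0) (ts ! N) (y 0) - y N)
          \<le> L * (\<Sum>n<N. C1 * CZ^4 * h powr (4 * \<alpha> - 1) * (ts ! Suc n - ts ! n))"
      proof (rule one_step_global_error[where S = "cball 0 R"])
        show "norm (wz_flow F Z ts (ts ! n) (ts ! N) u - wz_flow F Z ts (ts ! n) (ts ! N) v) \<le> L * norm (u - v)"
          if "n \<le> N" "u \<in> cball 0 R" "v \<in> cball 0 R" for n u v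
          using that partition_nth_le[OF facts(1) that(1) Nlen] facts(6)[of n] facts(6)[OF Nlen] Nlen
          by (intro lip ts) auto
        show "wz_flow F Z ts (ts ! n) (ts ! Suc n) (y n) \<in> cball 0 R" "y (Suc n) \<in> cball 0 R" if "n < N" for n
          using in_ball[OF ts, of n] that N by (simp_all add: y_def Let_def)
      qed (use Nlen L N step_err in auto)
      also have "(\<Sum>n<N. C1 * CZ^4 * h powr (4 * \<alpha> - 1) * (ts ! Suc n - ts ! n))
          = C1 * CZ^4 * h powr (4 * \<alpha> - 1) * (ts ! N)"
        using facts(2) by (simp add: sum_distrib_left[symmetric] sum_lessThan_telescope)
      also have "L * (C1 * CZ^4 * h powr (4 * \<alpha> - 1) * (ts ! N)) \<le> L * (C1 * CZ^4 * h powr (4 * \<alpha> - 1) * T)"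
        using facts(6)[OF Nlen] L C1 CZ T by (intro mult_left_mono) auto
      also have "\<dots> = L * (C1 * CZ^4 * T) * h powr (4 * \<alpha> - 1)" by simp
      also have "\<dots> \<le> L * (C1 * CZ^4 * T) * h powr p"
        using h h1 True pos by (intro mult_left_mono powr_mono') (auto simp: p_def)
      finally have A: "norm (wz_flow F Z ts (ts ! 0) (ts ! N) (y 0) - y N) \<le> L * (C1 * CZ^4 * T) * h powr p" .
      obtain U where U: "wz_solution F Z ts (ts ! 0) (ts ! (length ts - 1)) U" "U (ts ! 0) = Y 0"
        using wz_solution_exists[of 0 "length ts - 1" "Y 0"] Nlen by fastforce
      have "norm (Y (ts ! N) - U (ts ! N)) \<le> C\<^sub>W\<^sub>Z * h powr r\<^sub>0"
        unfolding h_def using U facts h True h1 Nlen by (intro wz[OF ts]) (auto simp: h_def)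
      also have "\<dots> \<le> C\<^sub>W\<^sub>Z * h powr p"
        using h h1 True wz_pos by (intro mult_left_mono powr_mono') (auto simp: p_def)
      finally have wz_err: "norm (Y (ts ! N) - U (ts ! N)) \<le> C\<^sub>W\<^sub>Z * h powr p" .
      have "wz_solution F Z ts (ts ! 0) (ts ! N) U"
        using partition_nth_le[OF facts(1) N] facts(4) by (intro wz_solution_restrict[OF U(1)]) auto
      then have "wz_flow F Z ts (ts ! 0) (ts ! N) (y 0) = U (ts ! N)"
        using wz_flow_eq[of 0 N U] Nlen U(2) by (simp add: y_def)
      then have "norm (Y (ts ! N) - y N) \<le> C\<^sub>W\<^sub>Z * h powr p + L * (C1 * CZ^4 * T) * h powr p"
        using norm_diff_triangle_le[OF wz_err] A by simp
      also have "\<dots> \<le> Cfin * h powr p"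
        using mult_nonneg_nonneg[OF less_imp_le[OF pos(1)] hp] by (simp add: Cfin_def distrib_right)
      finally show ?thesis by (simp add: h_def y_def)
    qed
  qed
  have "Cfin > 0" using pos wz_pos by (simp add: Cfin_def)
  then show ?thesis
    using main by (intro exI[of _ Cfin]) (auto simp: p_def[symmetric])
qed

end
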